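(* The problem of determining whether a given nondeterministic nominal automaton is residual is undecidable.
   Context: Nominal sets: $\mathbb{A}$ is a countably infinite set of atoms and $\mathrm{Perm}(\mathbb{A})$ is the group of finite permutations of $\mathbb{A}$. A nominal set is a set with a $\mathrm{Perm}(\mathbb{A})$-action in which every element $x$ has a finite support (a finite $A\subseteq\mathbb{A}$ such that $\pi x=x$ whenever $\pi$ fixes $A$ pointwise). A subset $U$ is equivariant if $\pi U=U$ for all $\pi$. A nominal set is orbit-finite if it is a finite union of orbits. A (nondeterministic) nominal automaton consists of an orbit-finite nominal alphabet $\Sigma$, an orbit-finite nominal set $Q$ of states, and equivariant subsets $I\subseteq Q$ (initial), $F\subseteq Q$ (final), $\delta\subseteq Q\times\Sigma\times Q$ (transitions), with the usual acceptance; $[\![q]\!]$ is the language accepted from $q$. It is residual if for each $q\in Q$ there is a word $w\in\Sigma^*$ with $[\![q]\!]=w^{-1}\mathcal{L}(\mathcal{A})=\{v\mid wv\in\mathcal{L}(\mathcal{A})\}$. Nominal automata are given as input by a standard finite representation of orbit-finite sets and equivariant relations. It is known (prior work) that universality ($\mathcal{L}(\mathcal{A})=\Sigma^*$?) is undecidable for nondeterministic nominal automata. *)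

theory Defs
  imports
    "HOL-Library.Countable"
    "HOL-Library.Infinite_Typeclass"
    "HOL-Library.Nat_Bijection"
    "HOL-Combinatorics.Perm"
    "HOL-Combinatorics.Multiset_Permutations"
begin

section \<open>Nominal sets\<close>

text \<open>
  The set of atoms is an arbitrary countably infinite type. The library type \<open>'a perm\<close> is exactly
  the group of finite permutations of \<open>'a\<close>.
\<close>

class atom = countable + infinite

instance nat :: atom ..

definition supports :: "('a perm \<Rightarrow> 'x \<Rightarrow> 'x) \<Rightarrow> 'a set \<Rightarrow> 'x \<Rightarrow> bool" where
  "supports act A x \<longleftrightarrow> (\<forall>\<pi>. (\<forall>a\<in>A. apply \<pi> a = a) \<longrightarrow> act \<pi> x = x)"

locale nominal_set =
  fixes act :: "'a::atom perm \<Rightarrow> 'x \<Rightarrow> 'x" and X :: "'x set"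
  assumes act_closed: "x \<in> X \<Longrightarrow> act \<pi> x \<in> X"
    and act_one: "x \<in> X \<Longrightarrow> act 1 x = x"
    and act_times: "x \<in> X \<Longrightarrow> act (\<pi> * \<sigma>) x = act \<pi> (act \<sigma> x)"
    and finite_support: "x \<in> X \<Longrightarrow> \<exists>A. finite A \<and> supports act A x"

definition nominal_orbit :: "('a perm \<Rightarrow> 'x \<Rightarrow> 'x) \<Rightarrow> 'x \<Rightarrow> 'x set" where
  "nominal_orbit act x = range (\<lambda>\<pi>. act \<pi> x)"

locale orbit_finite_set = nominal_set +
  assumes orbit_finite: "\<exists>R. finite R \<and> R \<subseteq> X \<and> X = (\<Union>x\<in>R. nominal_orbit act x)"

definition equivariant :: "('a perm \<Rightarrow> 'x \<Rightarrow> 'x) \<Rightarrow> 'x set \<Rightarrow> bool" where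
  "equivariant act U \<longleftrightarrow> (\<forall>\<pi>. act \<pi> ` U = U)"


section \<open>Nondeterministic nominal automata\<close>

record ('a, 's, 'q) nominal_nfa =
  alphabet :: "'s set"
  letter_act :: "'a perm \<Rightarrow> 's \<Rightarrow> 's"
  states :: "'q set"
  state_act :: "'a perm \<Rightarrow> 'q \<Rightarrow> 'q"
  initial :: "'q set"
  final :: "'q set"
  transitions :: "('q \<times> 's \<times> 'q) set"

locale nominal_automaton =
  fixes A :: "('a::atom, 's, 'q) nominal_nfa"
  assumes alphabet: "orbit_finite_set (letter_act A) (alphabet A)"
    and states: "orbit_finite_set (state_act A) (states A)"
    and initial: "initial A \<subseteq> states A" "equivariant (state_act A) (initial A)"
    and final: "final A \<subseteq> states A" "equivariant (state_act A) (final A)"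
    and transitions: "transitions A \<subseteq> states A \<times> alphabet A \<times> states A"
      "equivariant (\<lambda>\<pi>. map_prod (state_act A \<pi>) (map_prod (letter_act A \<pi>) (state_act A \<pi>)))
         (transitions A)"

primrec accepts_from :: "('a, 's, 'q) nominal_nfa \<Rightarrow> 'q \<Rightarrow> 's list \<Rightarrow> bool" where
  "accepts_from A q [] \<longleftrightarrow> q \<in> final A"
| "accepts_from A q (a # w) \<longleftrightarrow> (\<exists>q'. (q, a, q') \<in> transitions A \<and> accepts_from A q' w)"

definition state_language :: "('a, 's, 'q) nominal_nfa \<Rightarrow> 'q \<Rightarrow> 's list set" where
  "state_language A q = {w \<in> lists (alphabet A). accepts_from A q w}"

definition language :: "('a, 's, 'q) nominal_nfa \<Rightarrow> 's list set" where
  "language A = (\<Union>q\<in>initial A. state_language A q)"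

definition left_quotient :: "'s list \<Rightarrow> 's list set \<Rightarrow> 's list set" where
  "left_quotient w L = {v. w @ v \<in> L}"

definition residual :: "('a, 's, 'q) nominal_nfa \<Rightarrow> bool" where
  "residual A \<longleftrightarrow>
     (\<forall>q\<in>states A. \<exists>w\<in>lists (alphabet A). state_language A q = left_quotient w (language A))"


section \<open>Finite representations\<close>

text \<open>
  Every single-orbit nominal set is isomorphic to the set of \<open>k\<close>-tuples of distinct atoms modulo
  permutations of the coordinates from a subgroup \<open>S\<close> of the symmetric group on \<open>{..<k}\<close>. Such an
  orbit is represented by \<open>(k, S)\<close>, where \<open>S\<close> lists all elements of the subgroup, a permutation
  \<open>s\<close> being written in one-line notation \<open>[s 0, \<dots>, s (k - 1)]\<close>. (A nonempty finite set of
  permutations closed under composition is a subgroup.) An orbit-finite set is represented by the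
  list of its orbits.
\<close>

type_synonym orbit_rep = "nat \<times> nat list list"

definition wf_orbit :: "orbit_rep \<Rightarrow> bool" where
  "wf_orbit = (\<lambda>(k, S).
     set S \<subseteq> permutations_of_set {..<k} \<and> [0..<k] \<in> set S \<and>
     (\<forall>s\<in>set S. \<forall>t\<in>set S. map ((!) s) t \<in> set S))"

text \<open>
  The class of the tuple \<open>xs\<close> in the \<open>i\<close>-th orbit is tagged with \<open>i\<close>, so that the orbits in a
  list are disjoint.
\<close>

definition element :: "orbit_rep list \<Rightarrow> nat \<times> 'a list \<Rightarrow> nat \<times> 'a list set" where
  "element R = (\<lambda>(i, xs). (i, (\<lambda>s. map ((!) xs) s) ` set (snd (R ! i))))"

definition wf_tuple :: "orbit_rep list \<Rightarrow> nat \<times> 'a list \<Rightarrow> bool" where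
  "wf_tuple R = (\<lambda>(i, xs). i < length R \<and> length xs = fst (R ! i) \<and> distinct xs)"

definition elements :: "orbit_rep list \<Rightarrow> (nat \<times> 'a list set) set" where
  "elements R = element R ` {u. wf_tuple R u}"

definition element_act :: "'a perm \<Rightarrow> nat \<times> 'a list set \<Rightarrow> nat \<times> 'a list set" where
  "element_act \<pi> = map_prod id (image (map (apply \<pi>)))"

text \<open>
  An equivariant subset of an orbit-finite set is a union of orbits and is given by their indices.
  The transition relation is a finite union of orbits of triples, each given by one representative
  triple. A representative uses natural numbers as names for atoms; its orbit is obtained by
  instantiating the names injectively by atoms.
\<close>

record nfa_rep =
  alphabet_rep :: "orbit_rep list"
  states_rep :: "orbit_rep list"
  initial_rep :: "nat list"
  final_rep :: "nat list"
  transitions_rep :: "((nat \<times> nat list) \<times> (nat \<times> nat list) \<times> (nat \<times> nat list)) list"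

definition wf_nfa_rep :: "nfa_rep \<Rightarrow> bool" where
  "wf_nfa_rep R \<longleftrightarrow>
     (\<forall>r\<in>set (alphabet_rep R). wf_orbit r) \<and>
     (\<forall>r\<in>set (states_rep R). wf_orbit r) \<and>
     (\<forall>i\<in>set (initial_rep R). i < length (states_rep R)) \<and>
     (\<forall>i\<in>set (final_rep R). i < length (states_rep R)) \<and>
     (\<forall>(p, a, q)\<in>set (transitions_rep R).
        wf_tuple (states_rep R) p \<and> wf_tuple (alphabet_rep R) a \<and> wf_tuple (states_rep R) q)"

definition nfa_of :: "nfa_rep \<Rightarrow> ('a::atom, nat \<times> 'a list set, nat \<times> 'a list set) nominal_nfa"
  where
  "nfa_of R =
    \<lparr>alphabet = elements (alphabet_rep R),
     letter_act = element_act,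
     states = elements (states_rep R),
     state_act = element_act,
     initial = {x \<in> elements (states_rep R). fst x \<in> set (initial_rep R)},
     final = {x \<in> elements (states_rep R). fst x \<in> set (final_rep R)},
     transitions =
       {(element (states_rep R) (map_prod id (map \<rho>) p),
         element (alphabet_rep R) (map_prod id (map \<rho>) a),
         element (states_rep R) (map_prod id (map \<rho>) q)) | p a q \<rho>.
         (p, a, q) \<in> set (transitions_rep R) \<and> inj (\<rho> :: nat \<Rightarrow> 'a)}\<rparr>"


section \<open>Representations denote nominal automata\<close>

lemma apply_simps:
  "apply (\<pi> * \<sigma>) = apply \<pi> \<circ> apply \<sigma>" "apply (1 :: 'a perm) = id"
  by (simp_all add: apply_times)

lemma distinct_map_apply: "distinct (map (apply \<pi>) xs) = distinct xs"
  by (simp add: distinct_map inj_on_def apply_inj)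

lemma element_map:
  assumes "wf_tuple R u" "\<forall>r\<in>set R. wf_orbit r"
  shows "element R (map_prod id (map f) u) = map_prod id (image (map f)) (element R u)"
proof -
  obtain i xs where u: "u = (i, xs)" by fastforce
  obtain k S where kS: "R ! i = (k, S)" by fastforce
  from assms u kS have i: "i < length R" and k: "length xs = k"
    by (auto simp: wf_tuple_def)
  from assms(2) i kS have "wf_orbit (k, S)" by (metis nth_mem)
  then have sub: "set s \<subseteq> {..<k}" if "s \<in> set S" for s
    using that by (auto simp: wf_orbit_def permutations_of_set_def)
  have "map f (map ((!) xs) s) = map ((!) (map f xs)) s" if "s \<in> set S" for s
    using sub[OF that] k by (auto simp: subset_iff)
  then have "(\<lambda>s. map ((!) (map f xs)) s) ` set S = map f ` (\<lambda>s. map ((!) xs) s) ` set S"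
    unfolding image_image by (intro image_cong) simp_all
  then show ?thesis
    by (simp add: u kS element_def)
qed

lemma element_act_element:
  assumes "wf_tuple R u" "\<forall>r\<in>set R. wf_orbit r"
  shows "element_act \<pi> (element R u) = element R (map_prod id (map (apply \<pi>)) u)"
  by (simp add: element_act_def element_map[OF assms])

lemma wf_tuple_map: "wf_tuple R u \<Longrightarrow> inj f \<Longrightarrow> wf_tuple R (map_prod id (map f) u)"
  by (auto simp: wf_tuple_def distinct_map inj_on_def)

lemma element_act_1: "element_act 1 x = x"
  by (simp add: element_act_def apply_simps prod.map_id0 flip: id_def)

lemma element_act_times: "element_act (\<pi> * \<sigma>) x = element_act \<pi> (element_act \<sigma> x)"
  by (cases x) (simp add: element_act_def apply_simps image_image)

lemma element_act_closed:
  assumes "x \<in> elements R" "\<forall>r\<in>set R. wf_orbit r"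
  shows "element_act \<pi> x \<in> elements R"
proof -
  from assms(1) obtain u where u: "wf_tuple R u" "x = element R u"
    by (auto simp: elements_def)
  moreover have "inj (apply \<pi>)" by (simp add: bij_is_inj)
  ultimately show ?thesis
    using assms(2) by (auto simp: elements_def element_act_element wf_tuple_map)
qed

lemma nominal_set_elements:
  assumes "\<forall>r\<in>set R. wf_orbit r"
  shows "nominal_set element_act (elements R :: (nat \<times> 'a::atom list set) set)"
proof
  fix x :: "nat \<times> 'a list set" assume "x \<in> elements R"
  then obtain u where u: "wf_tuple R u" "x = element R u"
    by (auto simp: elements_def)
  have "supports element_act (set (snd u)) x"
    using u assms
    by (cases u) (auto simp: supports_def element_act_element map_idI)
  then show "\<exists>A. finite A \<and> supports element_act A x"
    by blast
qed (use assms in \<open>auto simp: element_act_1 element_act_times element_act_closed\<close>)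

lemma ex_perm_map:
  assumes "length xs = length ys" "distinct xs" "distinct ys"
  shows "\<exists>\<pi>. map (apply \<pi>) xs = ys"
proof -
  let ?U = "set xs \<union> set ys"
  have "card (?U - set xs) = card (?U - set ys)"
    using assms by (simp add: card_Diff_subset distinct_card)
  then obtain h where h: "bij_betw h (?U - set xs) (?U - set ys)"
    using finite_same_card_bij[of "?U - set xs" "?U - set ys"] by auto
  define g where "g x = the (map_of (zip xs ys) x)" for x
  have gn: "g (xs ! i) = ys ! i" if "i < length xs" for i
    using that assms by (simp add: g_def map_of_zip_nth)
  then have gmap: "map g xs = ys"
    using assms by (intro nth_equalityI) auto
  then have gb: "bij_betw g (set xs) (set ys)"
    using assms by (metis bij_betw_def distinct_map set_map)
  define f where "f x = (if x \<in> set xs then g x else if x \<in> ?U then h x else x)" for x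
  have f1: "bij_betw f (set xs) (set ys)"
    using gb by (simp add: f_def cong: bij_betw_cong)
  have f2: "bij_betw f (?U - set xs) (?U - set ys)"
    using h by (subst bij_betw_cong[of _ f h]) (auto simp: f_def)
  have "bij_betw f (set xs \<union> (?U - set xs)) (set ys \<union> (?U - set ys))"
    by (rule bij_betw_combine[OF f1 f2]) auto
  then have f3: "bij_betw f ?U ?U"
    by (simp add: Un_absorb1 Un_absorb2 Un_left_absorb Un_commute)
  have f4: "bij_betw f (- ?U) (- ?U)"
    by (subst bij_betw_cong[of _ f id]) (auto simp: f_def)
  have "bij f"
    using bij_betw_combine[OF f3 f4] by (metis Compl_partition Compl_disjoint)
  moreover have "finite {a. f a \<noteq> a}"
    by (rule finite_subset[of _ ?U]) (auto simp: f_def)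
  ultimately have "apply (Perm f) = f"
    by (simp add: Perm_inverse)
  moreover have "map f xs = ys"
    using gmap by (auto simp: f_def)
  ultimately show ?thesis
    by metis
qed

lemma ex_distinct_list: "\<exists>xs :: 'a::atom list. length xs = k \<and> distinct xs"
proof -
  obtain X :: "'a set" where "finite X" "card X = k"
    using infinite_arbitrarily_large[OF infinite_UNIV] by blast
  then show ?thesis
    by (metis distinct_card finite_distinct_list)
qed

lemma orbit_finite_set_elements:
  assumes R: "\<forall>r\<in>set R. wf_orbit r"
  shows "orbit_finite_set element_act (elements R :: (nat \<times> 'a::atom list set) set)"
proof -
  interpret nominal_set element_act "elements R :: (nat \<times> 'a list set) set"
    using R by (rule nominal_set_elements)
  define b :: "nat \<Rightarrow> 'a list" where "b k = (SOME xs. length xs = k \<and> distinct xs)" for k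
  have b: "length (b k) = k" "distinct (b k)" for k
    using someI_ex[OF ex_distinct_list[of k]] by (auto simp: b_def)
  let ?u = "\<lambda>i. (i, b (fst (R ! i)))"
  let ?B = "(\<lambda>i. element R (?u i)) ` {..<length R}"
  have wf: "wf_tuple R (?u i)" if "i < length R" for i
    using that b by (simp add: wf_tuple_def)
  have B: "?B \<subseteq> elements R"
    using wf by (auto simp: elements_def)
  have "x \<in> (\<Union>y\<in>?B. nominal_orbit element_act y)" if "x \<in> elements R" for x
  proof -
    from that obtain i xs where x: "wf_tuple R (i, xs)" "x = element R (i, xs)"
      by (auto simp: elements_def)
    then have i: "i < length R" "length xs = fst (R ! i)" "distinct xs"
      by (auto simp: wf_tuple_def)
    then obtain \<pi> where "map (apply \<pi>) (b (fst (R ! i))) = xs"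
      using ex_perm_map b by metis
    then have "x = element_act \<pi> (element R (?u i))"
      using wf[OF i(1)] R x by (simp add: element_act_element)
    then show ?thesis
      using i(1) by (auto simp: nominal_orbit_def)
  qed
  moreover have "nominal_orbit element_act y \<subseteq> elements R" if "y \<in> ?B" for y
    using act_closed[OF subsetD[OF B that]] by (simp add: nominal_orbit_def image_subset_iff)
  ultimately have "elements R = (\<Union>y\<in>?B. nominal_orbit element_act y)"
    by blast
  then show ?thesis
    using B by unfold_locales (intro exI[of _ ?B], auto)
qed

lemma equivariantI:
  assumes "\<And>\<pi> x. x \<in> U \<Longrightarrow> act \<pi> x \<in> U"
    and "\<And>x. act 1 x = x" and "\<And>\<pi> \<sigma> x. act (\<pi> * \<sigma>) x = act \<pi> (act \<sigma> x)"
  shows "equivariant act U"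
  unfolding equivariant_def
proof (intro allI equalityI subsetI)
  fix \<pi> x assume "x \<in> U"
  then have "act (inverse \<pi>) x \<in> U" by (rule assms(1))
  moreover have "x = act \<pi> (act (inverse \<pi>) x)"
    using assms(2,3) by (metis perm.right_inverse)
  ultimately show "x \<in> act \<pi> ` U" by blast
qed (use assms(1) in auto)

theorem nominal_automaton_nfa_of:
  assumes "wf_nfa_rep R"
  shows "nominal_automaton (nfa_of R :: ('a::atom, _, _) nominal_nfa)"
proof -
  let ?A = "alphabet_rep R" and ?Q = "states_rep R"
  let ?N = "nfa_of R :: ('a::atom, nat \<times> 'a list set, nat \<times> 'a list set) nominal_nfa"
  from assms have A: "\<forall>r\<in>set ?A. wf_orbit r" and Q: "\<forall>r\<in>set ?Q. wf_orbit r"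
    by (simp_all add: wf_nfa_rep_def)
  have wf: "wf_tuple ?Q p" "wf_tuple ?A a" "wf_tuple ?Q q"
    if "(p, a, q) \<in> set (transitions_rep R)" for p a q
    using assms that by (auto simp: wf_nfa_rep_def)
  let ?act = "\<lambda>\<pi>. map_prod (element_act \<pi>) (map_prod (element_act \<pi>) (element_act \<pi>))"
  have sel: "alphabet ?N = elements ?A" "letter_act ?N = element_act"
    "states ?N = elements ?Q" "state_act ?N = element_act"
    "initial ?N = {x \<in> elements ?Q. fst x \<in> set (initial_rep R)}"
    "final ?N = {x \<in> elements ?Q. fst x \<in> set (final_rep R)}"
    by (simp_all add: nfa_of_def)
  have fst_act: "fst (element_act \<pi> x) = fst x" for \<pi> :: "'a perm" and x
    by (simp add: element_act_def)
  have sub: "transitions ?N \<subseteq> elements ?Q \<times> elements ?A \<times> elements ?Q"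
  proof
    fix t assume "t \<in> transitions ?N"
    then obtain p a q \<rho> where "(p, a, q) \<in> set (transitions_rep R)" "inj \<rho>"
      "t = (element ?Q (map_prod id (map \<rho>) p), element ?A (map_prod id (map \<rho>) a),
        element ?Q (map_prod id (map \<rho>) q))"
      by (auto simp: nfa_of_def)
    then show "t \<in> elements ?Q \<times> elements ?A \<times> elements ?Q"
      using wf by (simp add: elements_def wf_tuple_map)
  qed
  have closed: "?act \<pi> t \<in> transitions ?N" if t: "t \<in> transitions ?N" for \<pi> :: "'a perm" and t
  proof -
    from t obtain p a q \<rho> where t: "(p, a, q) \<in> set (transitions_rep R)" "inj \<rho>"
      "t = (element ?Q (map_prod id (map \<rho>) p), element ?A (map_prod id (map \<rho>) a),
        element ?Q (map_prod id (map \<rho>) q))"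
      by (auto simp: nfa_of_def)
    let ?\<rho> = "apply \<pi> \<circ> \<rho>"
    have inj: "inj ?\<rho>"
      using t(2) by (simp add: inj_compose bij_is_inj)
    have "?act \<pi> t = (element ?Q (map_prod id (map ?\<rho>) p), element ?A (map_prod id (map ?\<rho>) a),
        element ?Q (map_prod id (map ?\<rho>) q))"
      using wf[OF t(1)] t(2,3) A Q
      by (simp add: element_act_element wf_tuple_map prod.map_comp)
    then show ?thesis
      using t(1) inj unfolding nfa_of_def nominal_nfa.simps mem_Collect_eq by blast
  qed
  have "equivariant ?act (transitions ?N)"
    by (rule equivariantI) (use closed in \<open>auto simp: element_act_1 element_act_times\<close>)
  moreover have "equivariant element_act {x \<in> elements ?Q :: (nat \<times> 'a list set) set. fst x \<in> I}" for I
    by (rule equivariantI)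
      (auto simp: element_act_1 element_act_times fst_act intro: element_act_closed Q[rule_format])
  ultimately show ?thesis
    using sub orbit_finite_set_elements[OF A] orbit_finite_set_elements[OF Q]
    by (intro nominal_automaton.intro) (simp_all add: sel)
qed


section \<open>Decidability\<close>

text \<open>
  Partial recursive functions. The relation \<open>computes f xs y\<close> says that \<open>f\<close> is defined on the
  argument list \<open>xs\<close> with value \<open>y\<close>. Terms carry no arity, but for each fixed length of argument
  lists the functions obtained are exactly the partial recursive functions of that arity. In
  \<open>mu\<close>, all values before the first zero have to be defined.
\<close>

datatype recf =
    Zero
  | Succ
  | Proj nat
  | Comp recf "recf list"
  | PrimRec recf recf
  | Mu recf

inductive computes :: "recf \<Rightarrow> nat list \<Rightarrow> nat \<Rightarrow> bool" where
  zero: "computes Zero xs 0"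
| succ: "computes Succ [x] (Suc x)"
| proj: "i < length xs \<Longrightarrow> computes (Proj i) xs (xs ! i)"
| comp: "list_all2 (\<lambda>g y. computes g xs y) gs ys \<Longrightarrow> computes f ys z \<Longrightarrow> computes (Comp f gs) xs z"
| prim_0: "computes f xs y \<Longrightarrow> computes (PrimRec f g) (0 # xs) y"
| prim_Suc: "computes (PrimRec f g) (n # xs) y \<Longrightarrow> computes g (n # y # xs) z \<Longrightarrow>
    computes (PrimRec f g) (Suc n # xs) z"
| mu: "computes f (n # xs) 0 \<Longrightarrow> (\<forall>m<n. \<exists>y. computes f (m # xs) (Suc y)) \<Longrightarrow>
    computes (Mu f) xs n"

text \<open>
  A decision problem with instances \<open>D\<close>, coded by natural numbers, is decidable if some partial
  recursive function answers it correctly on the codes of all instances; on other numbers it is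
  unconstrained. (If the set of codes is decidable, it can then be chosen total.)
\<close>

definition decidable_problem :: "('i \<Rightarrow> nat) \<Rightarrow> 'i set \<Rightarrow> ('i \<Rightarrow> bool) \<Rightarrow> bool" where
  "decidable_problem code D P \<longleftrightarrow> (\<exists>f. \<forall>x\<in>D. computes f [code x] (if P x then 1 else 0))"

definition encode_orbit :: "orbit_rep \<Rightarrow> nat" where
  "encode_orbit = (\<lambda>(k, S). prod_encode (k, list_encode (map list_encode S)))"

definition encode_tuple :: "nat \<times> nat list \<Rightarrow> nat" where
  "encode_tuple = (\<lambda>(i, xs). prod_encode (i, list_encode xs))"

definition encode_transition :: "(nat \<times> nat list) \<times> (nat \<times> nat list) \<times> (nat \<times> nat list) \<Rightarrow> nat"
  where
  "encode_transition = (\<lambda>(p, a, q).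
     prod_encode (encode_tuple p, prod_encode (encode_tuple a, encode_tuple q)))"

definition encode_nfa :: "nfa_rep \<Rightarrow> nat" where
  "encode_nfa R = list_encode
    [list_encode (map encode_orbit (alphabet_rep R)),
     list_encode (map encode_orbit (states_rep R)),
     list_encode (initial_rep R),
     list_encode (final_rep R),
     list_encode (map encode_transition (transitions_rep R))]"

end

theory Submission
  imports Defs "HOL-Library.Countable_Set"
begin

text \<open>The diagonalisation has to break a circle: \<open>h\<close> is to produce the code of an
  automaton whose alphabet and transitions already list the rules of \<open>h\<close>. The circle is
  broken by handing that part to \<open>h\<close> as data. The term \<open>recf_nfa\<close> is fixed
  once and for all and only wraps given codes, so \<open>h\<close> is determined first, then
  \<open>program h\<close>, and only then the numbers \<open>a\<close>, \<open>s\<close>,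
  \<open>t\<close>. No recursion theorem is invoked, and the bound \<open>N\<close> and the list of
  fixed transitions may be chosen without computing them. The wrapped part has to express three
  numerals, although a nominal automaton has only finitely many orbits of states. An
  \<open>Input\<close> letter therefore carries \<open>Suc t\<close> distinct atoms, which the goals
  force to name 0 up to \<open>t\<close>; this costs one goal transition per successor step, a list
  that is primitive recursive in \<open>t\<close>. The number \<open>t\<close> thus serves twice, as
  the code of the fixed transitions and as the length of the chain. The undecidability of
  universality is not presupposed: the contradiction is drawn directly from the assumed decision
  procedure.\<close>

text \<open>
  Evaluation of a partial recursive function \<open>h\<close> is a Horn program over atoms: atoms name natural
  numbers through facts ``\<open>a\<close> is zero'' and ``\<open>b\<close> is the successor of \<open>a\<close>'', and every rule
  instance is a letter. A word over such letters is a derivation if each premise of a letter is the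
  conclusion of a later letter and no atom is defined in two ways. Both kinds of violation can be
  guessed by a nominal automaton, so the automaton accepts everything unless \<open>h\<close> yields the value
  \<open>1\<close>. Every state is made residual by a letter leading to it from the initial state, except one
  state that accepts all words; that state is residual iff no derivation exists.

  A decision procedure \<open>f\<close> is then refuted by diagonalisation. The automaton depends on the input
  of \<open>h\<close> only through a simple chain of transitions, so its code is a recursive function of the
  codes \<open>a\<close>, \<open>s\<close>, \<open>t\<close> of its fixed part. Taking for \<open>h\<close> the function \<open>f\<close> applied to this code,
  and \<open>(a, s, t)\<close> as input, \<open>f\<close> answers ``residual'' iff a derivation exists, that is, iff the
  automaton is not residual.
\<close>

section \<open>Partial recursive functions\<close>

inductive_cases computes_ZeroE: "computes Zero xs y"
inductive_cases computes_SuccE: "computes Succ xs y"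
inductive_cases computes_ProjE: "computes (Proj i) xs y"
inductive_cases computes_CompE: "computes (Comp f gs) xs y"
inductive_cases computes_PrimRec_0E: "computes (PrimRec f g) (0 # xs) y"
inductive_cases computes_PrimRec_SucE: "computes (PrimRec f g) (Suc n # xs) y"
inductive_cases computes_MuE: "computes (Mu f) xs y"

lemma computes_fun: "computes f xs y \<Longrightarrow> computes f xs z \<Longrightarrow> y = z"
proof (induction arbitrary: z rule: computes.induct)
  case (comp xs gs ys f z')
  from comp.prems obtain ys' where ys': "list_all2 (\<lambda>g. computes g xs) gs ys'" "computes f ys' z"
    by (rule computes_CompE)
  have "ys = ys'"
    using comp.IH(1) ys'(1) by (auto simp: list_all2_conv_all_nth intro!: nth_equalityI)
  then show ?case using comp.IH(2) ys'(2) by simp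
next
  case (prim_0 f xs y g)
  from prim_0.prems show ?case
    by (rule computes_PrimRec_0E) (rule prim_0.IH)
next
  case (prim_Suc f g n xs y z')
  from prim_Suc.prems show ?case
    by (rule computes_PrimRec_SucE) (use prim_Suc.IH in blast)
next
  case (mu f n xs)
  from mu.prems have z: "computes f (z # xs) 0" "\<forall>m<z. \<exists>y. computes f (m # xs) (Suc y)"
    by (auto elim: computes_MuE)
  \<comment> \<open>At the smaller of two different results, \<open>f\<close> would have both the
    value zero and a positive value.\<close>
  have "\<not> n < z"
    using mu.IH(1) z(2) by blast
  moreover have "\<not> z < n"
    using mu.IH(2) z(1) by blast
  ultimately show ?case by simp
qed (blast elim: computes_ZeroE computes_SuccE computes_ProjE)+

lemma computes_Proj: "i < length xs \<Longrightarrow> y = xs ! i \<Longrightarrow> computes (Proj i) xs y"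
  by (simp add: proj)

lemma computes_PrimRec:
  assumes "computes f xs (F 0)" and "\<And>m. m < n \<Longrightarrow> computes g (m # F m # xs) (F (Suc m))"
  shows "computes (PrimRec f g) (n # xs) (F n)"
  using assms by (induction n) (auto intro: prim_0 prim_Suc)

section \<open>Arithmetic and the library codings of pairs and lists as recursive functions\<close>

primrec recf_const :: "nat \<Rightarrow> recf" where
  "recf_const 0 = Zero"
| "recf_const (Suc n) = Comp Succ [recf_const n]"

definition recf_Suc :: "recf \<Rightarrow> recf" where
  "recf_Suc f = Comp Succ [f]"

definition recf_add :: "recf \<Rightarrow> recf \<Rightarrow> recf" where
  "recf_add f g = Comp (PrimRec (Proj 0) (Comp Succ [Proj 1])) [f, g]"

text \<open>The recursion runs over the subtrahend, hence the swapped arguments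
  \<open>[g, f]\<close>; the inner \<open>PrimRec Zero (Proj 0)\<close> is the predecessor
  function.\<close>

definition recf_minus :: "recf \<Rightarrow> recf \<Rightarrow> recf" where
  "recf_minus f g =
     Comp (PrimRec (Proj 0) (Comp (PrimRec Zero (Proj 0)) [Proj 1])) [g, f]"

definition recf_triangle :: "recf \<Rightarrow> recf" where
  "recf_triangle f = Comp (PrimRec Zero (recf_add (Proj 1) (recf_Suc (Proj 0)))) [f]"

text \<open>Follows the library pairing: \<open>prod_encode (m, n)\<close> is
  \<open>triangle (m + n) + m\<close>.\<close>

definition recf_pair :: "recf \<Rightarrow> recf \<Rightarrow> recf" where
  "recf_pair f g = recf_add (recf_triangle (recf_add f g)) f"

definition recf_Cons :: "recf \<Rightarrow> recf \<Rightarrow> recf" where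
  "recf_Cons f g = recf_Suc (recf_pair f g)"

primrec recf_list :: "recf list \<Rightarrow> recf" where
  "recf_list [] = Zero"
| "recf_list (f # fs) = recf_Cons f (recf_list fs)"

lemma computes_Suc: "computes f xs m \<Longrightarrow> computes (recf_Suc f) xs (Suc m)"
  unfolding recf_Suc_def by (rule computes.comp[of _ _ "[m]"]) (auto intro: succ)

lemma computes_const: "computes (recf_const n) xs n"
  by (induction n) (auto intro: zero succ computes.comp[of _ _ "[_]"])

lemma computes_add:
  assumes "computes f xs m" "computes g xs n"
  shows "computes (recf_add f g) xs (m + n)"
proof -
  have "computes (PrimRec (Proj 0) (Comp Succ [Proj 1])) [m, n] (m + n)"
    by (rule computes_PrimRec[where F = "\<lambda>m. m + n"])
      (auto intro!: computes_Proj succ computes.comp[of _ _ "[_]"])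
  then show ?thesis
    using assms unfolding recf_add_def by (intro computes.comp[of _ _ "[m, n]"]) auto
qed

lemma computes_minus:
  assumes "computes f xs m" "computes g xs n"
  shows "computes (recf_minus f g) xs (m - n)"
proof -
  have pred: "computes (PrimRec Zero (Proj 0)) [k] (k - 1)" for k
    by (rule computes_PrimRec[where F = "\<lambda>k. k - 1"]) (auto intro!: computes_Proj zero)
  have "computes (PrimRec (Proj 0) (Comp (PrimRec Zero (Proj 0)) [Proj 1])) [n, m] (m - n)"
  proof (rule computes_PrimRec[where F = "\<lambda>n. m - n"])
    fix k
    have "computes (Comp (PrimRec Zero (Proj 0)) [Proj 1]) [k, m - k, m] (m - k - 1)"
      by (rule computes.comp[OF _ pred]) (simp add: computes_Proj)
    then show "computes (Comp (PrimRec Zero (Proj 0)) [Proj 1]) [k, m - k, m] (m - Suc k)"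
      by simp
  qed (simp add: computes_Proj)
  then show ?thesis
    using assms unfolding recf_minus_def by (intro computes.comp[of _ _ "[n, m]"]) auto
qed

lemma computes_triangle:
  assumes "computes f xs n"
  shows "computes (recf_triangle f) xs (triangle n)"
proof -
  have "computes (PrimRec Zero (recf_add (Proj 1) (recf_Suc (Proj 0)))) [n] (triangle n)"
    by (rule computes_PrimRec)
      (auto intro!: zero computes_add computes_Suc computes_Proj simp del: add_Suc_right)
  then show ?thesis
    using assms unfolding recf_triangle_def by (intro computes.comp[of _ _ "[n]"]) auto
qed

lemma computes_pair:
  assumes "computes f xs m" "computes g xs n"
  shows "computes (recf_pair f g) xs (prod_encode (m, n))"
  unfolding recf_pair_def prod_encode_def
  using assms by (simp add: computes_add computes_triangle)

lemma computes_Cons: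
  assumes "computes f xs m" "computes g xs (list_encode ms)"
  shows "computes (recf_Cons f g) xs (list_encode (m # ms))"
  unfolding recf_Cons_def using assms by (simp add: computes_Suc computes_pair)

lemma computes_list:
  "list_all2 (\<lambda>f. computes f xs) fs ms \<Longrightarrow> computes (recf_list fs) xs (list_encode ms)"
proof (induction fs arbitrary: ms)
  case (Cons f fs)
  then show ?case by (cases ms) (auto intro!: computes_Cons simp del: list_encode.simps(2))
qed (auto intro: zero)

text \<open>A list code grows at its head, so the interval is built from its upper end: after
  \<open>j\<close> rounds the accumulator \<open>Proj 1\<close> codes the last \<open>j\<close>
  entries, and \<open>n - j\<close> is put in front. The \<open>Suc n\<close> rounds are counted by
  \<open>Proj 0\<close>, while \<open>n\<close> is kept as the parameter
  \<open>Proj 2\<close>.\<close>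

definition recf_upt :: "recf \<Rightarrow> recf" where
  "recf_upt f =
     Comp (PrimRec Zero (recf_Cons (recf_minus (Proj 2) (Proj 0)) (Proj 1))) [recf_Suc f, f]"

lemma computes_upt:
  assumes "computes f xs n"
  shows "computes (recf_upt f) xs (list_encode [0..<Suc n])"
proof -
  have "computes (PrimRec Zero (recf_Cons (recf_minus (Proj 2) (Proj 0)) (Proj 1))) [Suc n, n]
     (list_encode [Suc n - Suc n..<Suc n])"
  proof (rule computes_PrimRec[where F = "\<lambda>j. list_encode [Suc n - j..<Suc n]"])
    fix m assume m: "m < Suc n"
    then have "[Suc n - Suc m..<Suc n] = (n - m) # [Suc n - m..<Suc n]"
      by (simp add: upt_rec Suc_diff_le)
    then show "computes (recf_Cons (recf_minus (Proj 2) (Proj 0)) (Proj 1))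
      [m, list_encode [Suc n - m..<Suc n], n] (list_encode [Suc n - Suc m..<Suc n])"
      by (auto intro!: computes_Cons computes_minus computes_Proj simp del: list_encode.simps(2))
  qed (simp add: zero)
  then show ?thesis
    using assms unfolding recf_upt_def
    by (intro computes.comp[of _ _ "[Suc n, n]"]) (auto intro: computes_Suc)
qed

section \<open>Evaluation as a Horn program\<close>

text \<open>\<open>PS\<close> defines an atom, so consistency leaves each atom one \<open>PS\<close>
  predecessor; \<open>PSc\<close> is the derived successor relation, open to every atom that names
  the predecessor. \<open>PGoal\<close> stands in for \<open>PG h 3\<close> because the code of the
  goal predicate is a constant inside \<open>recf_nfa\<close>, which is itself a part of
  \<open>h\<close>.\<close>

datatype pred = PZ | PS | PGoal | PEq | PSc | PG recf nat | PMu recf nat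

instance recf :: countable by countable_datatype
instance pred :: countable by countable_datatype

type_synonym 'b fact = "pred \<times> 'b list"
type_synonym rule = "nat \<times> nat fact \<times> nat fact list"

definition inst :: "(nat \<Rightarrow> 'b) \<Rightarrow> nat fact \<Rightarrow> 'b fact" where
  "inst \<sigma> = map_prod id (map \<sigma>)"

lemma inst_simp [simp]: "inst \<sigma> (p, vs) = (p, map \<sigma> vs)"
  by (simp add: inst_def)

fun arity :: "pred \<Rightarrow> nat" where
  "arity PZ = 1"
| "arity PS = 2"
| "arity PGoal = 4"
| "arity PEq = 2"
| "arity PSc = 2"
| "arity (PG g k) = Suc k"
| "arity (PMu f k) = Suc k"

text \<open>
  A rule \<open>(m, head, body)\<close> has the variables \<open>0, \<dots>, m - 1\<close>; \<open>PG g k\<close> is the graph of \<open>g\<close> on \<open>k\<close>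
  arguments, the last component being the value. Tuples of a representation consist of distinct
  atoms, so no variable may occur twice in a fact: equal numbers are passed on by \<open>PEq\<close>.
  \<open>PMu f k\<close> says that \<open>f\<close> is positive below its last component.
\<close>

fun recf_rules :: "recf \<Rightarrow> nat \<Rightarrow> rule list" where
  "recf_rules Zero k = [(Suc k, (PG Zero k, [0..<Suc k]), [(PZ, [k])])]"
| "recf_rules Succ k = (if k = 1 then [(2, (PG Succ 1, [0, 1]), [(PSc, [0, 1])])] else [])"
| "recf_rules (Proj i) k =
    (if i < k then [(Suc k, (PG (Proj i) k, [0..<Suc k]), [(PEq, [i, k])])] else [])"
| "recf_rules (Comp f gs) k =
    (Suc k + length gs, (PG (Comp f gs) k, [0..<Suc k]),
      (PG f (length gs), [Suc k..<Suc k + length gs] @ [k]) #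
      map (\<lambda>i. (PG (gs ! i) k, [0..<k] @ [Suc k + i])) [0..<length gs]) #
    recf_rules f (length gs) @ concat (map (\<lambda>g. recf_rules g k) gs)"
| "recf_rules (PrimRec f g) k =
    (if k = 0 then [] else
      [(Suc k, (PG (PrimRec f g) k, [0..<Suc k]),
         [(PZ, [0]), (PG f (k - 1), [1..<k] @ [k])]),
       (k + 3, (PG (PrimRec f g) k, [0..<Suc k]),
         [(PSc, [k + 1, 0]),
          (PG (PrimRec f g) k, [k + 1] @ [1..<k] @ [k + 2]),
          (PG g (k + 1), [k + 1, k + 2] @ [1..<k] @ [k])])]
      @ recf_rules f (k - 1) @ recf_rules g (k + 1))"
| "recf_rules (Mu f) k =
    [(k + 2, (PG (Mu f) k, [0..<Suc k]),
       [(PMu f k, [0..<Suc k]), (PG f (Suc k), [k] @ [0..<k] @ [k + 1]), (PZ, [k + 1])]),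
     (k + 1, (PMu f k, [0..<Suc k]), [(PZ, [k])]),
     (k + 4, (PMu f k, [0..<Suc k]),
       [(PSc, [k + 1, k]), (PMu f k, [0..<k] @ [k + 1]),
        (PG f (Suc k), [k + 1] @ [0..<k] @ [k + 2]), (PSc, [k + 3, k + 2])])]
    @ recf_rules f (Suc k)"

text \<open>The rules for \<open>PZ\<close> and \<open>PS\<close> have no premises: a derivation
  defines atoms at will, restrained only by consistency. \<open>PEq\<close> descends in parallel to
  two zeros. \<open>PSc\<close> has two rules because \<open>PEq\<close> never relates an atom to
  itself, instances being tuples of distinct atoms.\<close>

definition program :: "recf \<Rightarrow> rule list" where
  "program h =
    [(1, (PZ, [0]), []),
     (2, (PS, [0, 1]), []),
     (2, (PEq, [0, 1]), [(PZ, [0]), (PZ, [1])]),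
     (4, (PEq, [0, 1]), [(PS, [2, 0]), (PS, [3, 1]), (PEq, [2, 3])]),
     (2, (PSc, [0, 1]), [(PS, [0, 1])]),
     (3, (PSc, [0, 1]), [(PS, [2, 1]), (PEq, [0, 2])]),
     (4, (PGoal, [0..<4]), [(PG h 3, [0..<4])])]
    @ recf_rules h 3"

definition wf_rule :: "rule \<Rightarrow> bool" where
  "wf_rule = (\<lambda>(m, h, b). \<forall>(p, vs)\<in>set (h # b).
     length vs = arity p \<and> distinct vs \<and> set vs \<subseteq> {..<m})"

lemma wf_recf_rules: "\<forall>r\<in>set (recf_rules g k). wf_rule r"
proof (induction g k rule: recf_rules.induct)
  case (4 f gs k)
  then show ?case by (simp add: wf_rule_def ball_Un del: upt_Suc) auto
next
  case (5 f g k)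
  then show ?case by (cases k) (simp_all add: wf_rule_def ball_Un del: upt_Suc, auto)
qed (auto simp: wf_rule_def)

lemma wf_program:
  assumes "r \<in> set (program h)"
  shows "wf_rule r"
proof (cases "r \<in> set (recf_rules h 3)")
  case False
  with assms show ?thesis
    by (auto simp: program_def wf_rule_def)
qed (use wf_recf_rules in blast)

text \<open>
  An atom need not represent any number, hence facts are interpreted by equivalences and by
  implications from represented arguments to a represented value.
\<close>

fun holds :: "recf \<Rightarrow> ('b \<Rightarrow> nat \<Rightarrow> bool) \<Rightarrow> 'b fact \<Rightarrow> bool" where
  "holds h rep (PZ, as) \<longleftrightarrow> (\<forall>n. rep (as ! 0) n \<longleftrightarrow> n = 0)"
| "holds h rep (PS, as) \<longleftrightarrow> (\<forall>n. rep (as ! 1) n \<longleftrightarrow> (\<exists>m. n = Suc m \<and> rep (as ! 0) m))"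
| "holds h rep (PSc, as) \<longleftrightarrow> (\<forall>n. rep (as ! 1) n \<longleftrightarrow> (\<exists>m. n = Suc m \<and> rep (as ! 0) m))"
| "holds h rep (PEq, as) \<longleftrightarrow> (\<forall>n. rep (as ! 0) n \<longleftrightarrow> rep (as ! 1) n)"
| "holds h rep (PG g k, as) \<longleftrightarrow> (\<forall>xs. length xs = k \<and> (\<forall>i<k. rep (as ! i) (xs ! i)) \<longrightarrow>
    (\<exists>y. rep (as ! k) y \<and> computes g xs y))"
| "holds h rep (PMu f k, as) \<longleftrightarrow> (\<forall>xs. length xs = k \<and> (\<forall>i<k. rep (as ! i) (xs ! i)) \<longrightarrow>
    (\<exists>n. rep (as ! k) n \<and> (\<forall>m<n. \<exists>y. computes f (m # xs) (Suc y))))"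
| "holds h rep (PGoal, as) \<longleftrightarrow> (\<forall>xs. length xs = 3 \<and> (\<forall>i<3. rep (as ! i) (xs ! i)) \<longrightarrow>
    (\<exists>y. rep (as ! 3) y \<and> computes h xs y))"

section \<open>Soundness of the single rules\<close>

definition sound_rule :: "recf \<Rightarrow> ('b \<Rightarrow> nat \<Rightarrow> bool) \<Rightarrow> rule \<Rightarrow> bool" where
  "sound_rule h rep = (\<lambda>(m, H, b). \<forall>\<sigma>.
     (\<forall>x\<in>set b. holds h rep (inst \<sigma> x)) \<longrightarrow> holds h rep (inst \<sigma> H))"

lemma holds_PG_append:
  assumes "holds h rep (PG g k, as @ [b])" "length as = k" "list_all2 rep as xs"
  shows "\<exists>y. rep b y \<and> computes g xs y"
proof -
  have "length xs = k \<and> (\<forall>i<k. rep ((as @ [b]) ! i) (xs ! i))"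
    using assms by (simp add: list_all2_conv_all_nth nth_append)
  with assms(1) have "\<exists>y. rep ((as @ [b]) ! k) y \<and> computes g xs y"
    by simp
  with assms(2) show ?thesis by (simp add: nth_append)
qed

lemma holds_PMu_append:
  assumes "holds h rep (PMu f k, as @ [b])" "length as = k" "list_all2 rep as xs"
  shows "\<exists>n. rep b n \<and> (\<forall>m<n. \<exists>y. computes f (m # xs) (Suc y))"
proof -
  have "length xs = k \<and> (\<forall>i<k. rep ((as @ [b]) ! i) (xs ! i))"
    using assms by (simp add: list_all2_conv_all_nth nth_append)
  with assms(1) have "\<exists>n. rep ((as @ [b]) ! k) n \<and> (\<forall>m<n. \<exists>y. computes f (m # xs) (Suc y))"
    by simp
  with assms(2) show ?thesis by (simp add: nth_append)
qed

lemma list_all2_map_upt: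
  "list_all2 rep (map \<sigma> [0..<k]) xs \<longleftrightarrow>
    length xs = k \<and> (\<forall>i<k. rep (map \<sigma> [0..<Suc k] ! i) (xs ! i))"
  by (auto simp: list_all2_conv_all_nth nth_append)

lemma holds_PGI:
  assumes "\<And>xs. list_all2 rep (map \<sigma> [0..<k]) xs \<Longrightarrow> \<exists>y. rep (\<sigma> k) y \<and> computes g xs y"
  shows "holds h rep (inst \<sigma> (PG g k, [0..<Suc k]))"
  using assms unfolding list_all2_map_upt
  by (simp del: upt_Suc)

lemma holds_PMuI:
  assumes "\<And>xs. list_all2 rep (map \<sigma> [0..<k]) xs \<Longrightarrow>
    \<exists>n. rep (\<sigma> k) n \<and> (\<forall>m<n. \<exists>y. computes f (m # xs) (Suc y))"
  shows "holds h rep (inst \<sigma> (PMu f k, [0..<Suc k]))"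
  using assms unfolding list_all2_map_upt
  by (simp del: upt_Suc)

lemma sound_ruleI:
  assumes "\<And>\<sigma>. (\<And>x. x \<in> set b \<Longrightarrow> holds h rep (inst \<sigma> x)) \<Longrightarrow> holds h rep (inst \<sigma> H)"
  shows "sound_rule h rep (m, H, b)"
  using assms by (simp add: sound_rule_def)

lemma sound_Comp:
  "sound_rule h rep (m, (PG (Comp f gs) k, [0..<Suc k]),
      (PG f (length gs), [Suc k..<Suc k + length gs] @ [k]) #
      map (\<lambda>i. (PG (gs ! i) k, [0..<k] @ [Suc k + i])) [0..<length gs])"
proof (intro sound_ruleI holds_PGI)
  fix \<sigma> :: "nat \<Rightarrow> 'a" and xs
  let ?n = "length gs"
  let ?b = "(PG f ?n, [Suc k..<Suc k + ?n] @ [k]) #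
      map (\<lambda>i. (PG (gs ! i) k, [0..<k] @ [Suc k + i])) [0..<?n]"
  assume b: "\<And>x. x \<in> set ?b \<Longrightarrow> holds h rep (inst \<sigma> x)"
    and xs: "list_all2 rep (map \<sigma> [0..<k]) xs"
  have "\<exists>y. rep (\<sigma> (Suc k + i)) y \<and> computes (gs ! i) xs y" if "i < ?n" for i
  proof -
    have "(PG (gs ! i) k, [0..<k] @ [Suc k + i]) \<in> set ?b"
      using that by simp
    from b[OF this] have "holds h rep (PG (gs ! i) k, map \<sigma> [0..<k] @ [\<sigma> (Suc k + i)])"
      by (simp del: holds.simps)
    from holds_PG_append[OF this _ xs] show ?thesis by auto
  qed
  then obtain Y where Y: "\<And>i. i < ?n \<Longrightarrow> rep (\<sigma> (Suc k + i)) (Y i) \<and> computes (gs ! i) xs (Y i)"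
    by metis
  have "holds h rep (PG f ?n, map \<sigma> [Suc k..<Suc k + ?n] @ [\<sigma> k])"
    using b[of "(PG f ?n, [Suc k..<Suc k + ?n] @ [k])"] by (simp del: holds.simps upt_Suc)
  from holds_PG_append[OF this, of "map Y [0..<?n]"] Y
  obtain z where z: "rep (\<sigma> k) z" "computes f (map Y [0..<?n]) z"
    by (auto simp: list_all2_conv_all_nth simp del: upt_Suc)
  moreover have "list_all2 (\<lambda>g. computes g xs) gs (map Y [0..<?n])"
    using Y by (simp add: list_all2_conv_all_nth)
  ultimately show "\<exists>y. rep (\<sigma> k) y \<and> computes (Comp f gs) xs y"
    using comp by blast
qed

lemma sound_PrimRec_0:
  "sound_rule h rep (m, (PG (PrimRec f g) (Suc k), [0..<Suc (Suc k)]),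
     [(PZ, [0]), (PG f k, [1..<Suc k] @ [Suc k])])"
proof (intro sound_ruleI holds_PGI)
  fix \<sigma> :: "nat \<Rightarrow> 'a" and xs
  let ?b = "[(PZ, [0]), (PG f k, [1..<Suc k] @ [Suc k])]"
  assume b: "\<And>x. x \<in> set ?b \<Longrightarrow> holds h rep (inst \<sigma> x)"
    and "list_all2 rep (map \<sigma> [0..<Suc k]) xs"
  moreover have "[0..<Suc k] = 0 # [1..<Suc k]"
    by (simp add: upt_conv_Cons)
  ultimately obtain n ys where xs: "xs = n # ys" "rep (\<sigma> 0) n" "list_all2 rep (map \<sigma> [1..<Suc k]) ys"
    by (auto simp: list_all2_Cons1 simp del: upt_Suc)
  have "n = 0"
    using b[of "(PZ, [0])"] xs by simp
  have "holds h rep (PG f k, map \<sigma> [1..<Suc k] @ [\<sigma> (Suc k)])"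
    using b[of "(PG f k, [1..<Suc k] @ [Suc k])"] by (simp del: holds.simps upt_Suc)
  from holds_PG_append[OF this _ xs(3)] obtain y where "rep (\<sigma> (Suc k)) y" "computes f ys y"
    by (auto simp del: upt_Suc)
  then show "\<exists>y. rep (\<sigma> (Suc k)) y \<and> computes (PrimRec f g) xs y"
    using \<open>n = 0\<close> xs(1) prim_0 by blast
qed

lemma sound_PrimRec_Suc:
  "sound_rule h rep (m, (PG (PrimRec f g) (Suc k), [0..<Suc (Suc k)]),
     [(PSc, [u, 0]), (PG (PrimRec f g) (Suc k), [u] @ [1..<Suc k] @ [v]),
      (PG g (Suc (Suc k)), [u, v] @ [1..<Suc k] @ [Suc k])])"
proof (intro sound_ruleI holds_PGI)
  fix \<sigma> :: "nat \<Rightarrow> 'a" and xs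
  let ?b = "[(PSc, [u, 0]), (PG (PrimRec f g) (Suc k), [u] @ [1..<Suc k] @ [v]),
      (PG g (Suc (Suc k)), [u, v] @ [1..<Suc k] @ [Suc k])]"
  assume b: "\<And>x. x \<in> set ?b \<Longrightarrow> holds h rep (inst \<sigma> x)"
    and "list_all2 rep (map \<sigma> [0..<Suc k]) xs"
  moreover have "[0..<Suc k] = 0 # [1..<Suc k]"
    by (simp add: upt_conv_Cons)
  ultimately obtain n ys where xs: "xs = n # ys" "rep (\<sigma> 0) n" "list_all2 rep (map \<sigma> [1..<Suc k]) ys"
    by (auto simp: list_all2_Cons1 simp del: upt_Suc)
  obtain l where l: "n = Suc l" "rep (\<sigma> u) l"
    using b[of "(PSc, [u, 0])"] xs by auto
  have "holds h rep (PG (PrimRec f g) (Suc k), (\<sigma> u # map \<sigma> [1..<Suc k]) @ [\<sigma> v])"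
    using b[of "(PG (PrimRec f g) (Suc k), [u] @ [1..<Suc k] @ [v])"]
    by (simp del: holds.simps upt_Suc)
  from holds_PG_append[OF this, of "l # ys"] xs l
  obtain y where y: "rep (\<sigma> v) y" "computes (PrimRec f g) (l # ys) y"
    by (auto simp del: upt_Suc)
  have "holds h rep (PG g (Suc (Suc k)), (\<sigma> u # \<sigma> v # map \<sigma> [1..<Suc k]) @ [\<sigma> (Suc k)])"
    using b[of "(PG g (Suc (Suc k)), [u, v] @ [1..<Suc k] @ [Suc k])"]
    by (simp del: holds.simps upt_Suc)
  from holds_PG_append[OF this, of "l # y # ys"] xs l y
  obtain z where "rep (\<sigma> (Suc k)) z" "computes g (l # y # ys) z"
    by (auto simp del: upt_Suc)
  then show "\<exists>y. rep (\<sigma> (Suc k)) y \<and> computes (PrimRec f g) xs y"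
    using y l xs(1) prim_Suc by blast
qed

text \<open>The result atom \<open>k\<close> is not among the arguments, so some premise has to say
  that it represents a number at all; this is why the meaning of \<open>PMu\<close> includes the
  existence of \<open>n\<close>.\<close>

lemma sound_Mu:
  "sound_rule h rep (m, (PG (Mu f) k, [0..<Suc k]),
     [(PMu f k, [0..<Suc k]), (PG f (Suc k), [k] @ [0..<k] @ [u]), (PZ, [u])])"
proof (intro sound_ruleI holds_PGI)
  fix \<sigma> :: "nat \<Rightarrow> 'a" and xs
  let ?b = "[(PMu f k, [0..<Suc k]), (PG f (Suc k), [k] @ [0..<k] @ [u]), (PZ, [u])]"
  assume b: "\<And>x. x \<in> set ?b \<Longrightarrow> holds h rep (inst \<sigma> x)"
    and xs: "list_all2 rep (map \<sigma> [0..<k]) xs"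
  have "holds h rep (PMu f k, map \<sigma> [0..<k] @ [\<sigma> k])"
    using b[of "(PMu f k, [0..<Suc k])"] by (simp del: holds.simps)
  from holds_PMu_append[OF this _ xs] obtain n
    where n: "rep (\<sigma> k) n" "\<forall>m<n. \<exists>y. computes f (m # xs) (Suc y)"
    by auto
  have "holds h rep (PG f (Suc k), (\<sigma> k # map \<sigma> [0..<k]) @ [\<sigma> u])"
    using b[of "(PG f (Suc k), [k] @ [0..<k] @ [u])"] by (simp del: holds.simps)
  from holds_PG_append[OF this, of "n # xs"] n xs
  obtain z where "rep (\<sigma> u) z" "computes f (n # xs) z"
    by auto
  moreover have "holds h rep (PZ, [\<sigma> u])"
    using b[of "(PZ, [u])"] by simp
  ultimately show "\<exists>y. rep (\<sigma> k) y \<and> computes (Mu f) xs y"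
    using n by (auto intro: mu)
qed

lemma sound_PMu_Suc:
  "sound_rule h rep (m, (PMu f k, [0..<Suc k]),
     [(PSc, [u, k]), (PMu f k, [0..<k] @ [u]),
      (PG f (Suc k), [u] @ [0..<k] @ [v]), (PSc, [w, v])])"
proof (intro sound_ruleI holds_PMuI)
  fix \<sigma> :: "nat \<Rightarrow> 'a" and xs
  let ?b = "[(PSc, [u, k]), (PMu f k, [0..<k] @ [u]),
      (PG f (Suc k), [u] @ [0..<k] @ [v]), (PSc, [w, v])]"
  assume b: "\<And>x. x \<in> set ?b \<Longrightarrow> holds h rep (inst \<sigma> x)"
    and xs: "list_all2 rep (map \<sigma> [0..<k]) xs"
  have "holds h rep (PMu f k, map \<sigma> [0..<k] @ [\<sigma> u])"
    using b[of "(PMu f k, [0..<k] @ [u])"] by (simp del: holds.simps)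
  from holds_PMu_append[OF this _ xs] obtain n
    where n: "rep (\<sigma> u) n" "\<forall>m<n. \<exists>y. computes f (m # xs) (Suc y)"
    by auto
  have "holds h rep (PG f (Suc k), (\<sigma> u # map \<sigma> [0..<k]) @ [\<sigma> v])"
    using b[of "(PG f (Suc k), [u] @ [0..<k] @ [v])"] by (simp del: holds.simps)
  from holds_PG_append[OF this, of "n # xs"] n xs
  obtain z where z: "rep (\<sigma> v) z" "computes f (n # xs) z"
    by auto
  \<comment> \<open>The atom \<open>w\<close> names the predecessor of the value of \<open>f\<close>
    and thereby certifies that this value is positive.\<close>
  have "\<exists>y. z = Suc y"
    using b[of "(PSc, [w, v])"] z by auto
  then have "\<forall>m<Suc n. \<exists>y. computes f (m # xs) (Suc y)"
    using n z by (auto simp: less_Suc_eq)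
  moreover have "rep (\<sigma> k) (Suc n)"
    using b[of "(PSc, [u, k])"] n by auto
  ultimately show "\<exists>n. rep (\<sigma> k) n \<and> (\<forall>m<n. \<exists>y. computes f (m # xs) (Suc y))"
    by blast
qed

lemma sound_recf_rules: "r \<in> set (recf_rules g k) \<Longrightarrow> sound_rule h rep r"
proof (induction g k rule: recf_rules.induct)
  case (1 k)
  have "sound_rule h rep (Suc k, (PG Zero k, [0..<Suc k]), [(PZ, [k])])"
    by (intro sound_ruleI holds_PGI) (auto intro: zero)
  with 1 show ?case by simp
next
  case (2 k)
  have "sound_rule h rep (2, (PG Succ 1, [0..<Suc 1]), [(PSc, [0, 1])])"
  proof (intro sound_ruleI holds_PGI)
    fix \<sigma> :: "nat \<Rightarrow> 'a" and xs
    assume "\<And>x. x \<in> set [(PSc, [0, 1])] \<Longrightarrow> holds h rep (inst \<sigma> x)"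
      and "list_all2 rep (map \<sigma> [0..<1]) xs"
    then obtain x where "xs = [x]" "rep (\<sigma> 1) (Suc x)"
      by (auto simp: list_all2_Cons1)
    then show "\<exists>y. rep (\<sigma> 1) y \<and> computes Succ xs y"
      using succ by blast
  qed
  with 2 show ?case by (simp split: if_splits)
next
  case (3 i k)
  then have i: "i < k" and r: "r = (Suc k, (PG (Proj i) k, [0..<Suc k]), [(PEq, [i, k])])"
    by (auto split: if_splits)
  have "sound_rule h rep (Suc k, (PG (Proj i) k, [0..<Suc k]), [(PEq, [i, k])])"
  proof (intro sound_ruleI holds_PGI)
    fix \<sigma> :: "nat \<Rightarrow> 'a" and xs
    assume "\<And>x. x \<in> set [(PEq, [i, k])] \<Longrightarrow> holds h rep (inst \<sigma> x)"
      and "list_all2 rep (map \<sigma> [0..<k]) xs"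
    with i have "rep (\<sigma> k) (xs ! i)" "i < length xs"
      by (auto simp: list_all2_conv_all_nth)
    then show "\<exists>y. rep (\<sigma> k) y \<and> computes (Proj i) xs y"
      using proj by blast
  qed
  with r show ?case by simp
next
  case (4 f gs k)
  then show ?case
    using sound_Comp[of h rep _ f gs k] by (auto simp del: upt_Suc)
next
  case (5 f g k)
  then obtain k' where "k = Suc k'" by (cases k) auto
  with 5 show ?case
    using sound_PrimRec_0[of h rep _ f g k'] sound_PrimRec_Suc[of h rep _ f g k']
    by (auto simp del: upt_Suc)
next
  case (6 f k)
  have "sound_rule h rep (k + 1, (PMu f k, [0..<Suc k]), [(PZ, [k])])"
    by (intro sound_ruleI holds_PMuI) auto
  with 6 show ?case
    using sound_Mu[of h rep _ f k] sound_PMu_Suc[of h rep _ f k]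
    by (auto simp del: upt_Suc)
qed

text \<open>The heads \<open>PZ\<close> and \<open>PS\<close> are set apart because their rules have
  no premises from which anything about \<open>rep\<close> could follow; their meaning comes from
  the consistency of the whole word, through \<open>repr_PZ\<close> and
  \<open>repr_PS\<close>.\<close>

lemma sound_program:
  assumes "r \<in> set (program h)" "fst (fst (snd r)) \<noteq> PZ" "fst (fst (snd r)) \<noteq> PS"
  shows "sound_rule h rep r"
proof (cases "r \<in> set (recf_rules h 3)")
  case False
  with assms consider
      "r = (2, (PEq, [0, 1]), [(PZ, [0]), (PZ, [1])])"
    | "r = (4, (PEq, [0, 1]), [(PS, [2, 0]), (PS, [3, 1]), (PEq, [2, 3])])"
    | "r = (2, (PSc, [0, 1]), [(PS, [0, 1])])"
    | "r = (3, (PSc, [0, 1]), [(PS, [2, 1]), (PEq, [0, 2])])"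
    | "r = (4, (PGoal, [0..<4]), [(PG h 3, [0..<4])])"
    by (auto simp: program_def)
  then show ?thesis
    by cases (simp_all add: sound_rule_def)
qed (rule sound_recf_rules)

section \<open>Derivations as words, and their soundness\<close>

type_synonym 'b ground = "nat \<times> 'b list"

definition wf_instance :: "rule list \<Rightarrow> 'b ground \<Rightarrow> bool" where
  "wf_instance rs = (\<lambda>(l, \<theta>). l < length rs \<and> length \<theta> = fst (rs ! l) \<and> distinct \<theta>)"

definition head :: "rule list \<Rightarrow> 'b ground \<Rightarrow> 'b fact" where
  "head rs = (\<lambda>(l, \<theta>). inst ((!) \<theta>) (fst (snd (rs ! l))))"

definition body :: "rule list \<Rightarrow> 'b ground \<Rightarrow> 'b fact set" where
  "body rs = (\<lambda>(l, \<theta>). inst ((!) \<theta>) ` set (snd (snd (rs ! l))))"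

text \<open>Premises are sought to the right because an automaton reads from left to right: it can
  guess a premise when it reads the letter and then watch the rest of the word for its absence. The
  order also rules out circular arguments.\<close>

primrec justified :: "rule list \<Rightarrow> 'b ground list \<Rightarrow> bool" where
  "justified rs [] \<longleftrightarrow> True"
| "justified rs (x # w) \<longleftrightarrow> body rs x \<subseteq> head rs ` set w \<and> justified rs w"

definition consistent :: "'b fact set \<Rightarrow> bool" where
  "consistent F \<longleftrightarrow>
     (\<forall>a b. (PS, [a, b]) \<in> F \<longrightarrow> (PZ, [b]) \<notin> F \<and> (\<forall>c. (PS, [c, b]) \<in> F \<longrightarrow> c = a))"

text \<open>Being the least solution, it gives no value to atoms on a cycle of \<open>PS\<close>
  facts when \<open>F\<close> is consistent.\<close>

inductive repr :: "'b fact set \<Rightarrow> 'b \<Rightarrow> nat \<Rightarrow> bool" for F where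
  repr_0: "(PZ, [a]) \<in> F \<Longrightarrow> repr F a 0"
| repr_Suc: "(PS, [a, b]) \<in> F \<Longrightarrow> repr F a n \<Longrightarrow> repr F b (Suc n)"

lemma repr_PZ:
  assumes "consistent F" "(PZ, [a]) \<in> F"
  shows "repr F a n \<longleftrightarrow> n = 0"
proof
  assume "repr F a n"
  then show "n = 0"
    by cases (use assms in \<open>auto simp: consistent_def\<close>)
qed (use assms in \<open>simp add: repr_0\<close>)

lemma repr_PS:
  assumes "consistent F" "(PS, [a, b]) \<in> F"
  shows "repr F b n \<longleftrightarrow> (\<exists>m. n = Suc m \<and> repr F a m)"
proof
  assume "repr F b n"
  then show "\<exists>m. n = Suc m \<and> repr F a m"
    by cases (use assms in \<open>auto simp: consistent_def\<close>)
qed (use assms in \<open>auto intro: repr_Suc\<close>)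

text \<open>
  The atoms \<open>xs ! 0, \<dots>, xs ! t\<close> represent \<open>0, \<dots>, t\<close>; the goal is that \<open>h\<close> maps \<open>a\<close>, \<open>s\<close>, \<open>t\<close> to \<open>1\<close>.
\<close>

definition goals :: "nat \<Rightarrow> nat \<Rightarrow> nat \<Rightarrow> 'b list \<Rightarrow> 'b fact set" where
  "goals a s t xs = {(PZ, [xs ! 0]), (PGoal, [xs ! a, xs ! s, xs ! t, xs ! 1])} \<union>
     (\<lambda>k. (PS, [xs ! k, xs ! Suc k])) ` {..<t}"

lemma inst_wf:
  assumes "wf_instance rs x" "\<forall>r\<in>set rs. wf_rule r" "y \<in> insert (head rs x) (body rs x)"
  shows "length (snd y) = arity (fst y)" "distinct (snd y)"
proof -
  obtain l \<theta> where x: "x = (l, \<theta>)" by fastforce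
  obtain m h b where r: "rs ! l = (m, h, b)" by (metis prod_cases3)
  have l: "l < length rs" "length \<theta> = m" "distinct \<theta>"
    using assms(1) x r by (auto simp: wf_instance_def)
  then have "wf_rule (m, h, b)"
    using assms(2) r by (metis nth_mem)
  moreover have "\<exists>z\<in>set (h # b). y = inst ((!) \<theta>) z"
    using assms(3) x r by (auto simp: head_def body_def)
  then obtain z where z: "z \<in> set (h # b)" "y = inst ((!) \<theta>) z" ..
  moreover obtain p vs where "z = (p, vs)" by fastforce
  ultimately have vs: "length vs = arity p" "distinct vs" "set vs \<subseteq> {..<m}"
    and y: "y = (p, map ((!) \<theta>) vs)"
    unfolding wf_rule_def by (blast, blast, blast, simp)
  have "inj_on ((!) \<theta>) (set vs)"
    using vs(3) l by (intro inj_on_nth) auto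
  with vs y show "length (snd y) = arity (fst y)" "distinct (snd y)"
    by (simp_all add: distinct_map)
qed

text \<open>\<open>F\<close> stays fixed while the induction passes to suffixes: what an atom
  represents depends on all definitions in the word, the premises of a letter only on later
  letters.\<close>

lemma justified_holds:
  assumes "consistent F" "justified (program h) w" "\<forall>x\<in>set w. wf_instance (program h) x"
    "head (program h) ` set w \<subseteq> F" "y \<in> head (program h) ` set w"
  shows "holds h (repr F) y"
  using assms(2-5)
proof (induction w arbitrary: y)
  case (Cons x w)
  show ?case
  proof (cases "y \<in> head (program h) ` set w")
    case False
    with Cons.prems have y: "y = head (program h) x" by auto
    obtain l \<theta> where x: "x = (l, \<theta>)" by fastforce
    obtain m H b where r: "program h ! l = (m, H, b)" by (metis prod_cases3)
    obtain p vs where H: "H = (p, vs)" by fastforce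
    have l: "(m, H, b) \<in> set (program h)"
      using Cons.prems(2) x r by (auto simp: wf_instance_def) (metis nth_mem)
    have yp: "y = (p, map ((!) \<theta>) vs)"
      using y x r H by (simp add: head_def)
    have "length (snd y) = arity (fst y)"
      by (rule inst_wf(1)[of "program h" x]) (use Cons.prems(2) y wf_program in auto)
    then have len: "length (snd y) = arity p"
      using yp by simp
    have yF: "y \<in> F" using Cons.prems y by auto
    consider "p = PZ" | "p = PS" | "p \<noteq> PZ" "p \<noteq> PS" by blast
    then show ?thesis
    proof cases
      case 1
      then obtain a where "y = (PZ, [a])"
        using len yp by (cases y) (auto simp: length_Suc_conv)
      then show ?thesis
        using yF assms(1) by (simp add: repr_PZ)
    next
      case 2
      then obtain a c where "y = (PS, [a, c])"
        using len yp by (cases y) (auto simp: length_Suc_conv numeral_eq_Suc)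
      then show ?thesis
        using yF assms(1) by (simp add: repr_PS)
    next
      case 3
      have "holds h (repr F) (inst ((!) \<theta>) z)" if "z \<in> set b" for z
      proof -
        have "inst ((!) \<theta>) z \<in> body (program h) x"
          using that x r by (simp add: body_def)
        then have "inst ((!) \<theta>) z \<in> head (program h) ` set w"
          using Cons.prems(1) by auto
        then show ?thesis
          by (rule Cons.IH[rotated -1]) (use Cons.prems in auto)
      qed
      moreover have "sound_rule h (repr F) (m, H, b)"
        by (rule sound_program[OF l]) (use 3 H in simp_all)
      ultimately have "holds h (repr F) (inst ((!) \<theta>) H)"
        unfolding sound_rule_def by blast
      then show ?thesis
        by (simp add: yp H)
    qed
  qed (use Cons in auto)
qed simp

text \<open>Along the chain of goals, \<open>xs ! k\<close> is forced to represent \<open>k\<close>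
  and nothing else. The goal fact then speaks about the intended arguments, and the value it
  provides can only be that of \<open>xs ! 1\<close>.\<close>

lemma justified_sound:
  fixes w :: "'b ground list"
  assumes "justified (program h) w" "\<forall>x\<in>set w. wf_instance (program h) x"
    "consistent (head (program h) ` set w)" "goals a s t xs \<subseteq> head (program h) ` set w"
    and "1 \<le> t" "a \<le> t" "s \<le> t"
  shows "computes h [a, s, t] 1"
proof -
  let ?F = "head (program h) ` set w"
  have holds: "holds h (repr ?F) y" if "y \<in> goals a s t xs" for y
    using justified_holds[OF assms(3,1,2)] that assms(4) by blast
  have repr: "repr ?F (xs ! k) n \<longleftrightarrow> n = k" if "k \<le> t" for k n
    using that
  proof (induction k arbitrary: n)
    case 0
    show ?case using holds[of "(PZ, [xs ! 0])"] by (simp add: goals_def)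
  next
    case (Suc k)
    then show ?case using holds[of "(PS, [xs ! k, xs ! Suc k])"] by (auto simp: goals_def)
  qed
  have g: "holds h (repr ?F) (PGoal, [xs ! a, xs ! s, xs ! t, xs ! 1])"
    by (rule holds) (simp add: goals_def)
  have "\<forall>i<3. repr ?F ([xs ! a, xs ! s, xs ! t, xs ! 1] ! i) ([a, s, t] ! i)"
    using repr assms(5-7) by (auto simp: less_Suc_eq numeral_3_eq_3)
  then have "\<exists>y. repr ?F ([xs ! a, xs ! s, xs ! t, xs ! 1] ! 3) y \<and> computes h [a, s, t] y"
    using g[unfolded holds.simps] by (metis length_Cons list.size(3) numeral_3_eq_3)
  then have "\<exists>y. repr ?F (xs ! 1) y \<and> computes h [a, s, t] y"
    by simp
  then show ?thesis
    using repr[OF assms(5)] by auto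
qed

section \<open>Completeness: true computations have consistent derivations\<close>

lemma justified_append:
  "justified rs u \<Longrightarrow> justified rs v \<Longrightarrow> justified rs (u @ v)"
  by (induction u) auto

lemma map_nth_middle:
  "map ((!) (as @ bs @ cs)) [length as..<length as + length bs] = bs"
  by (rule nth_equalityI) (auto simp: nth_append)

lemma map_nth_prefix: "map ((!) (as @ bs)) [0..<length as] = as"
  using map_nth_middle[of "[]"] by simp

text \<open>
  For completeness, all atoms are given fixed numerical values and predecessors in advance; then
  derivations can be concatenated without introducing conflicting definitions.
\<close>

locale numbering =
  fixes val :: "'b \<Rightarrow> nat" and pre :: "'b \<Rightarrow> 'b"
  assumes infinite_val: "infinite {a. val a = n}"
    and val_pre: "val a = Suc n \<Longrightarrow> val (pre a) = n"
    and pre_inj: "val a = Suc m \<Longrightarrow> val b = Suc n \<Longrightarrow> pre a = pre b \<Longrightarrow> a = b"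
begin

definition proper :: "'b fact \<Rightarrow> bool" where
  "proper x \<longleftrightarrow> (\<forall>a. x = (PZ, [a]) \<longrightarrow> val a = 0) \<and>
     (\<forall>a b. x = (PS, [a, b]) \<longrightarrow> val b = Suc (val a) \<and> a = pre b)"

definition proof_word :: "rule list \<Rightarrow> 'b ground list \<Rightarrow> bool" where
  "proof_word rs w \<longleftrightarrow> justified rs w \<and> (\<forall>x\<in>set w. wf_instance rs x \<and> proper (head rs x))"

definition derivable :: "rule list \<Rightarrow> 'b fact \<Rightarrow> bool" where
  "derivable rs y \<longleftrightarrow> (\<exists>w. proof_word rs w \<and> y \<in> head rs ` set w)"

lemma proof_word_append: "proof_word rs u \<Longrightarrow> proof_word rs v \<Longrightarrow> proof_word rs (u @ v)"
  by (auto simp: proof_word_def justified_append)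

lemma proof_word_consistent: "proof_word rs w \<Longrightarrow> consistent (head rs ` set w)"
  unfolding proof_word_def consistent_def proper_def
  by (clarsimp simp: image_iff) (metis nat.distinct(1))

lemma derivable_finite:
  assumes "finite Y" "\<forall>y\<in>Y. derivable rs y"
  shows "\<exists>w. proof_word rs w \<and> Y \<subseteq> head rs ` set w"
  using assms
proof (induction Y)
  case empty
  then show ?case by (intro exI[of _ "[]"]) (simp add: proof_word_def)
next
  case (insert y Y)
  then obtain u v where "proof_word rs u" "Y \<subseteq> head rs ` set u"
    "proof_word rs v" "y \<in> head rs ` set v"
    by (auto simp: derivable_def)
  then show ?case
    by (intro exI[of _ "u @ v"]) (auto simp: proof_word_append)
qed

lemma derivableI:
  assumes "(m, H, b) \<in> set rs" "length \<theta> = m" "distinct \<theta>"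
    "\<And>x. x \<in> set b \<Longrightarrow> derivable rs (inst ((!) \<theta>) x)"
    "y = inst ((!) \<theta>) H" "proper y"
  shows "derivable rs y"
proof -
  obtain l where l: "l < length rs" "rs ! l = (m, H, b)"
    using assms(1) by (auto simp: in_set_conv_nth)
  obtain w where w: "proof_word rs w" "inst ((!) \<theta>) ` set b \<subseteq> head rs ` set w"
    using derivable_finite[of "inst ((!) \<theta>) ` set b" rs] assms(4) by auto
  then have "proof_word rs ((l, \<theta>) # w)"
    using assms l by (auto simp: proof_word_def wf_instance_def head_def body_def)
  then show ?thesis
    unfolding derivable_def using assms(5) l
    by (intro exI[of _ "(l, \<theta>) # w"]) (simp add: head_def)
qed

text \<open>The variables of a rule become distinct atoms even when their numbers coincide, so every
  number needs an unlimited supply of names.\<close>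

lemma fresh:
  assumes "finite F"
  obtains bs where "map val bs = ns" "distinct bs" "set bs \<inter> F = {}"
  using assms
proof (induction ns arbitrary: F thesis)
  case (Cons n ns)
  obtain b where b: "val b = n" "b \<notin> F"
    using infinite_val[of n] Cons.prems(2) by (metis (mono_tags, lifting) finite_subset mem_Collect_eq subsetI)
  obtain bs where bs: "map val bs = ns" "distinct bs" "set bs \<inter> insert b F = {}"
    using Cons.IH Cons.prems(2) by blast
  show ?case
    by (rule Cons.prems(1)[of "b # bs"]) (use b bs in auto)
qed simp

context
  fixes h rs assumes rs: "set (program h) \<subseteq> set rs"
begin

lemma base_rules:
  "(1, (PZ, [0]), []) \<in> set rs"
  "(2, (PS, [0, 1]), []) \<in> set rs"
  "(2, (PEq, [0, 1]), [(PZ, [0]), (PZ, [1])]) \<in> set rs"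
  "(4, (PEq, [0, 1]), [(PS, [2, 0]), (PS, [3, 1]), (PEq, [2, 3])]) \<in> set rs"
  "(2, (PSc, [0, 1]), [(PS, [0, 1])]) \<in> set rs"
  "(3, (PSc, [0, 1]), [(PS, [2, 1]), (PEq, [0, 2])]) \<in> set rs"
  "(4, (PGoal, [0..<4]), [(PG h 3, [0..<4])]) \<in> set rs"
  by (rule subsetD[OF rs], simp add: program_def)+

lemma derivable_PZ: "val a = 0 \<Longrightarrow> derivable rs (PZ, [a])"
  by (rule derivableI[OF base_rules(1), of "[a]"]) (simp_all add: proper_def)

lemma derivable_PS:
  assumes "val b = Suc n"
  shows "derivable rs (PS, [pre b, b])"
proof -
  have "val (pre b) = n" using assms by (rule val_pre)
  with assms have "pre b \<noteq> b" by auto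
  with assms \<open>val (pre b) = n\<close> show ?thesis
    by - (rule derivableI[OF base_rules(2), of "[pre b, b]"], simp_all add: proper_def)
qed

text \<open>Injectivity of \<open>pre\<close> keeps the two descending chains apart; otherwise they
  could meet, and the premise \<open>PEq\<close> would relate an atom to itself.\<close>

lemma derivable_PEq: "val a = n \<Longrightarrow> val b = n \<Longrightarrow> a \<noteq> b \<Longrightarrow> derivable rs (PEq, [a, b])"
proof (induction n arbitrary: a b)
  case 0
  then show ?case
    by - (rule derivableI[OF base_rules(3), of "[a, b]"], auto simp: proper_def derivable_PZ)
next
  case (Suc n)
  have p: "val (pre a) = n" "val (pre b) = n" "pre a \<noteq> pre b"
    using Suc.prems val_pre pre_inj by blast+
  have "a \<noteq> pre a" "a \<noteq> pre b" "b \<noteq> pre a" "b \<noteq> pre b"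
    using p(1,2) Suc.prems(1,2) by (metis n_not_Suc_n)+
  with p Suc.prems(3) have "distinct [a, b, pre a, pre b]"
    by simp
  with Suc.IH[OF p] Suc.prems(1,2)[THEN derivable_PS] show ?case
    by - (rule derivableI[OF base_rules(4), of "[a, b, pre a, pre b]"],
        auto simp: proper_def)
qed

lemma derivable_PSc:
  assumes "val b = Suc (val a)"
  shows "derivable rs (PSc, [a, b])"
proof (cases "a = pre b")
  case True
  with assms derivable_PS[OF assms] have "a \<noteq> b" "derivable rs (PS, [a, b])"
    by auto
  then show ?thesis
    by - (rule derivableI[OF base_rules(5), of "[a, b]"], simp_all add: proper_def)
next
  case False
  have p: "val (pre b) = val a"
    using assms by (rule val_pre)
  then have "derivable rs (PEq, [a, pre b])"
    using False derivable_PEq by blast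
  moreover have "distinct [a, b, pre b]"
    using assms False p by (auto dest: arg_cong[of _ _ val])
  ultimately show ?thesis
    using derivable_PS[OF assms] by - (rule derivableI[OF base_rules(6), of "[a, b, pre b]"], auto simp: proper_def)
qed

lemma proper_PG [simp]: "proper (PG g k, as)" and proper_PMu [simp]: "proper (PMu f k, as)"
  and proper_PGoal [simp]: "proper (PGoal, as)"
  by (simp_all add: proper_def)

lemma derivable_Comp:
  assumes "set (recf_rules (Comp f gs) k) \<subseteq> set rs" "distinct (as @ [b])" "length as = k"
    "distinct bs" "set bs \<inter> set (as @ [b]) = {}" "length bs = length gs"
    "\<And>i. i < length gs \<Longrightarrow> derivable rs (PG (gs ! i) k, as @ [bs ! i])"
    "derivable rs (PG f (length gs), bs @ [b])"
  shows "derivable rs (PG (Comp f gs) k, as @ [b])"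
proof (rule derivableI)
  let ?b = "(PG f (length gs), [Suc k..<Suc k + length gs] @ [k]) #
      map (\<lambda>i. (PG (gs ! i) k, [0..<k] @ [Suc k + i])) [0..<length gs]"
  let ?\<theta> = "as @ [b] @ bs"
  show "(Suc k + length gs, (PG (Comp f gs) k, [0..<Suc k]), ?b) \<in> set rs"
    using assms(1) by (simp del: upt_Suc)
  show "length ?\<theta> = Suc k + length gs" "distinct ?\<theta>"
    using assms by auto
  show "(PG (Comp f gs) k, as @ [b]) = inst ((!) ?\<theta>) (PG (Comp f gs) k, [0..<Suc k])"
    using map_nth_prefix[of as "[b] @ bs"] assms(3) by (simp add: nth_append)
  have 1: "inst ((!) ?\<theta>) (PG f (length gs), [Suc k..<Suc k + length gs] @ [k]) =
      (PG f (length gs), bs @ [b])"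
    using map_nth_middle[of "as @ [b]" bs "[]"] assms(3,6)
    by (simp add: nth_append del: upt_Suc)
  have 2: "inst ((!) ?\<theta>) (PG (gs ! i) k, [0..<k] @ [Suc k + i]) = (PG (gs ! i) k, as @ [bs ! i])" for i
    using assms(3) map_nth_prefix[of as "[b] @ bs"] by (simp add: nth_append)
  show "derivable rs (inst ((!) ?\<theta>) x)" if "x \<in> set ?b" for x
    using that assms(7,8) 1 2 by (auto simp del: inst_simp upt_Suc)
qed simp

lemma derivable_PrimRec_0:
  assumes "set (recf_rules (PrimRec f g) (Suc k)) \<subseteq> set rs" "distinct (a # as @ [b])"
    "length as = k" "val a = 0" "derivable rs (PG f k, as @ [b])"
  shows "derivable rs (PG (PrimRec f g) (Suc k), a # as @ [b])"
proof (rule derivableI)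
  let ?b = "[(PZ, [0]), (PG f k, [1..<Suc k] @ [Suc k])]"
  let ?\<theta> = "a # as @ [b]"
  show "(Suc (Suc k), (PG (PrimRec f g) (Suc k), [0..<Suc (Suc k)]), ?b) \<in> set rs"
    using assms(1) by (simp del: upt_Suc)
  show "length ?\<theta> = Suc (Suc k)" "distinct ?\<theta>"
    using assms by auto
  show "(PG (PrimRec f g) (Suc k), ?\<theta>) =
      inst ((!) ?\<theta>) (PG (PrimRec f g) (Suc k), [0..<Suc (Suc k)])"
    using map_nth_prefix[of "a # as" "[b]"] assms(3) by (simp add: nth_append)
  have "map ((!) ?\<theta>) [1..<Suc k] = as"
    using map_nth_middle[of "[a]" as "[b]"] assms(3) by (simp del: upt_Suc)
  then have "inst ((!) ?\<theta>) (PG f k, [1..<Suc k] @ [Suc k]) = (PG f k, as @ [b])"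
    using assms(3) by (simp add: nth_append del: upt_Suc)
  then show "derivable rs (inst ((!) ?\<theta>) x)" if "x \<in> set ?b" for x
    using that assms(5) derivable_PZ[OF assms(4)] by (auto simp del: upt_Suc)
qed simp

lemma derivable_PrimRec_Suc:
  assumes "set (recf_rules (PrimRec f g) (Suc k)) \<subseteq> set rs" "distinct (a # as @ [b, u, v])"
    "length as = k" "val a = Suc (val u)"
    "derivable rs (PG (PrimRec f g) (Suc k), u # as @ [v])"
    "derivable rs (PG g (Suc (Suc k)), u # v # as @ [b])"
  shows "derivable rs (PG (PrimRec f g) (Suc k), a # as @ [b])"
proof (rule derivableI)
  let ?b = "[(PSc, [Suc (Suc k), 0]),
      (PG (PrimRec f g) (Suc k), [Suc (Suc k)] @ [1..<Suc k] @ [Suc (Suc (Suc k))]),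
      (PG g (Suc (Suc k)), [Suc (Suc k), Suc (Suc (Suc k))] @ [1..<Suc k] @ [Suc k])]"
  let ?\<theta> = "a # as @ [b, u, v]"
  show "(k + 4, (PG (PrimRec f g) (Suc k), [0..<Suc (Suc k)]), ?b) \<in> set rs"
    using assms(1) by (simp add: numeral_eq_Suc del: upt_Suc)
  show "length ?\<theta> = k + 4" "distinct ?\<theta>"
    using assms by auto
  show "(PG (PrimRec f g) (Suc k), a # as @ [b]) =
      inst ((!) ?\<theta>) (PG (PrimRec f g) (Suc k), [0..<Suc (Suc k)])"
    using map_nth_prefix[of "a # as" "[b, u, v]"] assms(3) by (simp add: nth_append)
  have "map ((!) ?\<theta>) [1..<Suc k] = as"
    using map_nth_middle[of "[a]" as "[b, u, v]"] assms(3) by (simp del: upt_Suc)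
  then have "map (inst ((!) ?\<theta>)) ?b = [(PSc, [u, a]), (PG (PrimRec f g) (Suc k), u # as @ [v]),
      (PG g (Suc (Suc k)), u # v # as @ [b])]"
    using assms(3) by (simp add: nth_append del: upt_Suc)
  then show "derivable rs (inst ((!) ?\<theta>) x)" if "x \<in> set ?b" for x
    using that assms(5,6) derivable_PSc[OF assms(4)] by (auto simp del: inst_simp upt_Suc)
qed simp

text \<open>\<open>Y m\<close> is the value of \<open>f\<close> at \<open>m\<close>. The
  derivability of these values is assumed for all names \<open>c\<close> and \<open>v\<close>, since
  the induction picks fresh ones at each level.\<close>

lemma derivable_PMu:
  assumes "set (recf_rules (Mu f) k) \<subseteq> set rs" "length as = k"
    "\<And>c v m. val c = m \<Longrightarrow> m < n \<Longrightarrow> val v = Y m \<Longrightarrow> distinct (c # as @ [v]) \<Longrightarrow>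
       derivable rs (PG f (Suc k), c # as @ [v])"
    "\<And>m. m < n \<Longrightarrow> Y m \<noteq> 0" "val c = n" "distinct (as @ [c])"
  shows "derivable rs (PMu f k, as @ [c])"
  using assms(3-)
proof (induction n arbitrary: c)
  case 0
  show ?case
  proof (rule derivableI)
    show "(Suc k, (PMu f k, [0..<Suc k]), [(PZ, [k])]) \<in> set rs"
      using assms(1) by (simp del: upt_Suc)
    show "(PMu f k, as @ [c]) = inst ((!) (as @ [c])) (PMu f k, [0..<Suc k])"
      using map_nth_prefix[of as "[c]"] assms(2) by (simp add: nth_append)
  qed (use 0 assms(2) in \<open>auto simp: nth_append derivable_PZ\<close>)
next
  case (Suc n)
  obtain y where y: "Y n = Suc y"
    using Suc.prems(2)[of n] by (cases "Y n") auto
  \<comment> \<open>Names for the predecessor of \<open>c\<close>, for the value of \<open>f\<close>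
    there, and for the predecessor of that value.\<close>
  obtain bs where bs: "map val bs = [n, Suc y, y]" "distinct bs" "set bs \<inter> set (as @ [c]) = {}"
    by (rule fresh[OF finite_set, of "[n, Suc y, y]" "as @ [c]"])
  then obtain u v w where uvw: "bs = [u, v, w]" "val u = n" "val v = Suc y" "val w = y"
    by (auto simp: map_eq_Cons_conv)
  let ?\<theta> = "as @ [c] @ bs"
  let ?b = "[(PSc, [k + 1, k]), (PMu f k, [0..<k] @ [k + 1]),
        (PG f (Suc k), [k + 1] @ [0..<k] @ [k + 2]), (PSc, [k + 3, k + 2])]"
  show ?case
  proof (rule derivableI)
    show "(k + 4, (PMu f k, [0..<Suc k]), ?b) \<in> set rs"
      using assms(1) by (simp del: upt_Suc)
    show "(PMu f k, as @ [c]) = inst ((!) ?\<theta>) (PMu f k, [0..<Suc k])"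
      using map_nth_prefix[of as "[c] @ bs"] assms(2) by (simp add: nth_append)
    show "distinct ?\<theta>" using bs Suc.prems(4) by auto
    have m: "map (inst ((!) ?\<theta>)) ?b =
        [(PSc, [u, c]), (PMu f k, as @ [u]), (PG f (Suc k), u # as @ [v]), (PSc, [w, v])]"
      using assms(2) map_nth_prefix[of as "[c] @ bs"] uvw(1) by (simp add: nth_append)
    have "derivable rs (PSc, [u, c])" "derivable rs (PSc, [w, v])"
      using uvw Suc.prems(3) by (simp_all add: derivable_PSc)
    moreover have "derivable rs (PMu f k, as @ [u])"
      by (rule Suc.IH) (use Suc.prems bs uvw in auto)
    moreover have "derivable rs (PG f (Suc k), u # as @ [v])"
      by (rule Suc.prems(1)[of _ n]) (use Suc.prems bs uvw y in auto)
    ultimately show "derivable rs (inst ((!) ?\<theta>) x)" if "x \<in> set ?b" for x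
      using that m by (auto simp del: inst_simp upt_Suc)
  qed (use uvw assms(2) in auto)
qed

lemma derivable_Mu:
  assumes "set (recf_rules (Mu f) k) \<subseteq> set rs" "distinct (as @ [b, z])" "length as = k"
    "val z = 0" "derivable rs (PMu f k, as @ [b])" "derivable rs (PG f (Suc k), b # as @ [z])"
  shows "derivable rs (PG (Mu f) k, as @ [b])"
proof (rule derivableI)
  let ?b = "[(PMu f k, [0..<Suc k]), (PG f (Suc k), [k] @ [0..<k] @ [k + 1]), (PZ, [k + 1])]"
  let ?\<theta> = "as @ [b, z]"
  show "(k + 2, (PG (Mu f) k, [0..<Suc k]), ?b) \<in> set rs"
    using assms(1) by (simp del: upt_Suc)
  show "(PG (Mu f) k, as @ [b]) = inst ((!) ?\<theta>) (PG (Mu f) k, [0..<Suc k])"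
    using map_nth_prefix[of as "[b, z]"] assms(3) by (simp add: nth_append)
  have "map (inst ((!) ?\<theta>)) ?b = [(PMu f k, as @ [b]), (PG f (Suc k), b # as @ [z]), (PZ, [z])]"
    using assms(3) map_nth_prefix[of as "[b, z]"] by (simp add: nth_append)
  then show "derivable rs (inst ((!) ?\<theta>) x)" if "x \<in> set ?b" for x
    using that assms(5,6) derivable_PZ[OF assms(4)] by (auto simp del: inst_simp upt_Suc)
qed (use assms in auto)

text \<open>Induction over the computation, for all distinct names of arguments and result at once;
  intermediate values receive fresh names, so distinctness survives every rule instance.\<close>

lemma derivable_PG:
  assumes "computes g xs y" "set (recf_rules g (length xs)) \<subseteq> set rs"
    "distinct (as @ [b])" "map val as = xs" "val b = y"
  shows "derivable rs (PG g (length xs), as @ [b])"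
  using assms
proof (induction g xs y arbitrary: as b rule: computes.induct)
  case (zero xs)
  let ?k = "length xs"
  have k: "length as = ?k" using zero(3) by auto
  show ?case
  proof (rule derivableI)
    show "(Suc ?k, (PG Zero ?k, [0..<Suc ?k]), [(PZ, [?k])]) \<in> set rs"
      using zero.prems by (simp del: upt_Suc)
    show "(PG Zero ?k, as @ [b]) = inst ((!) (as @ [b])) (PG Zero ?k, [0..<Suc ?k])"
      using map_nth_prefix[of as "[b]"] k by (simp add: nth_append)
  qed (use zero.prems k in \<open>auto simp: nth_append derivable_PZ\<close>)
next
  case (succ x)
  then obtain a where a: "as = [a]" "val a = x" by (auto simp: map_eq_Cons_conv)
  show ?case
  proof (rule derivableI[where \<theta> = "[a, b]"])
    show "(2, (PG Succ 1, [0, 1]), [(PSc, [0, 1])]) \<in> set rs"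
      using succ.prems by simp
  qed (use succ.prems a derivable_PSc in auto)
next
  case (proj i xs)
  let ?k = "length xs"
  have k: "length as = ?k" using proj.prems(3) by auto
  have "as ! i \<in> set as" using proj.hyps k by simp
  then have ne: "as ! i \<noteq> b" using proj.prems(2) by auto
  have "val (as ! i) = val b"
    using proj.prems(3,4) proj.hyps k by (metis nth_map)
  then have eq: "derivable rs (PEq, [as ! i, b])"
    using ne derivable_PEq by blast
  show ?case
  proof (rule derivableI)
    show "(Suc ?k, (PG (Proj i) ?k, [0..<Suc ?k]), [(PEq, [i, ?k])]) \<in> set rs"
      using proj.prems proj.hyps by (simp del: upt_Suc)
    show "(PG (Proj i) ?k, as @ [b]) = inst ((!) (as @ [b])) (PG (Proj i) ?k, [0..<Suc ?k])"
      using map_nth_prefix[of as "[b]"] k by (simp add: nth_append)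
  qed (use proj.prems proj.hyps k eq in \<open>auto simp: nth_append\<close>)
next
  case (comp xs gs ys f z)
  let ?k = "length xs"
  have k: "length as = ?k" using comp.prems(3) by auto
  obtain bs where bs: "map val bs = ys" "distinct bs" "set bs \<inter> set (as @ [b]) = {}"
    by (rule fresh[OF finite_set, of ys "as @ [b]"])
  have len: "length gs = length ys" "length bs = length ys"
    using comp.IH(1) bs(1) by (auto simp: list_all2_lengthD)
  show ?case
  proof (rule derivable_Comp[where bs = bs])
    show "derivable rs (PG f (length gs), bs @ [b])"
      unfolding len(1)
      by (rule comp.IH(2)) (use comp.prems bs len in auto)
    show "derivable rs (PG (gs ! i) ?k, as @ [bs ! i])" if i: "i < length gs" for i
    proof -
      have "bs ! i \<in> set bs" using i len by simp
      then have "distinct (as @ [bs ! i])"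
        using bs comp.prems(2) by auto
      moreover have "val (bs ! i) = ys ! i"
        using bs(1) i len by (metis nth_map)
      moreover have "set (recf_rules (gs ! i) ?k) \<subseteq> set rs"
        using comp.prems(1) nth_mem[OF i] by auto
      ultimately show ?thesis
        using comp.IH(1) comp.prems(3) i by (auto simp: list_all2_conv_all_nth)
    qed
  qed (use comp.prems bs len k in auto)
next
  case (prim_0 f xs y g)
  then obtain a as' where a: "as = a # as'" "val a = 0" "map val as' = xs"
    by (auto simp: map_eq_Cons_conv)
  have "derivable rs (PG (PrimRec f g) (Suc (length xs)), a # as' @ [b])"
    by (rule derivable_PrimRec_0, use prim_0.prems a in auto)
      (use prim_0 a in auto)
  then show ?case using a(1) by simp
next
  case (prim_Suc f g n xs y z)
  then obtain a as' where a: "as = a # as'" "val a = Suc n" "map val as' = xs"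
    by (auto simp: map_eq_Cons_conv)
  obtain bs where bs: "map val bs = [n, y]" "distinct bs" "set bs \<inter> set (as @ [b]) = {}"
    by (rule fresh[OF finite_set, of "[n, y]" "as @ [b]"])
  then obtain u v where uv: "bs = [u, v]" "val u = n" "val v = y"
    by (auto simp: map_eq_Cons_conv)
  have d: "distinct (a # as' @ [b, u, v])"
    using bs uv a prim_Suc.prems(2) by auto
  have "derivable rs (PG (PrimRec f g) (length (n # xs)), (u # as') @ [v])"
    by (rule prim_Suc.IH(1)) (use prim_Suc.prems a uv d in auto)
  then have 1: "derivable rs (PG (PrimRec f g) (Suc (length xs)), u # as' @ [v])"
    by simp
  have "derivable rs (PG g (length (n # y # xs)), (u # v # as') @ [b])"
    by (rule prim_Suc.IH(2)) (use prim_Suc.prems a uv d in auto)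
  then have 2: "derivable rs (PG g (Suc (Suc (length xs))), u # v # as' @ [b])"
    by simp
  have "set (recf_rules (PrimRec f g) (Suc (length xs))) \<subseteq> set rs"
    using prim_Suc.prems(1) by (simp only: list.size(4) add_Suc_right add_0_right)
  moreover have "length as' = length xs"
    using a(3) by (metis length_map)
  moreover have "val a = Suc (val u)"
    using a(2) uv(2) by simp
  ultimately have "derivable rs (PG (PrimRec f g) (Suc (length xs)), a # as' @ [b])"
    using d 1 2 by - (rule derivable_PrimRec_Suc)
  then show ?case using a(1) by simp
next
  case (mu f n xs)
  let ?k = "length xs"
  have k: "length as = ?k" using mu.prems(3) by auto
  have rf: "set (recf_rules f (Suc ?k)) \<subseteq> set rs"
    using mu.prems(1) by simp
  obtain zs where "map val zs = [0]" "distinct zs" "set zs \<inter> set (as @ [b]) = {}"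
    by (rule fresh[OF finite_set, of "[0]" "as @ [b]"])
  then obtain z where z: "val z = 0" "z \<notin> set (as @ [b])"
    by (auto simp: map_eq_Cons_conv)
  \<comment> \<open>The value of \<open>f\<close> at \<open>m\<close> must not depend on the atoms
    naming it: \<open>y\<close> is placed before \<open>c\<close> and \<open>v\<close>, so that a
    function \<open>Y\<close> can be chosen.\<close>
  have "\<forall>m<n. \<exists>y. \<forall>c v. val c = m \<longrightarrow> val v = Suc y \<longrightarrow> distinct (c # as @ [v]) \<longrightarrow>
      derivable rs (PG f (Suc ?k), c # as @ [v])"
  proof (intro allI impI)
    fix m assume "m < n"
    with mu.IH(2) obtain y where
      y: "set (recf_rules f (length (m # xs))) \<subseteq> set rs \<longrightarrow> (\<forall>as b. distinct (as @ [b]) \<longrightarrow>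
        map val as = m # xs \<longrightarrow> val b = Suc y \<longrightarrow> derivable rs (PG f (length (m # xs)), as @ [b]))"
      by meson
    have "derivable rs (PG f (Suc ?k), c # as @ [v])"
      if "val c = m" "val v = Suc y" "distinct (c # as @ [v])" for c v
      using y[rule_format, of "c # as" v] that rf mu.prems(3) by simp
    then show "\<exists>y. \<forall>c v. val c = m \<longrightarrow> val v = Suc y \<longrightarrow> distinct (c # as @ [v]) \<longrightarrow>
      derivable rs (PG f (Suc ?k), c # as @ [v])"
      by blast
  qed
  then obtain Y where Y: "\<And>m c v. m < n \<Longrightarrow> val c = m \<Longrightarrow> val v = Suc (Y m) \<Longrightarrow>
      distinct (c # as @ [v]) \<Longrightarrow> derivable rs (PG f (Suc ?k), c # as @ [v])"
    by metis
  have "derivable rs (PMu f ?k, as @ [b])"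
    by (rule derivable_PMu[where n = n and Y = "\<lambda>m. Suc (Y m)"]) (use mu.prems k Y in auto)
  moreover have "derivable rs (PG f (length (n # xs)), (b # as) @ [z])"
    by (rule mu.IH(1)) (use mu.prems z in auto)
  then have "derivable rs (PG f (Suc ?k), b # as @ [z])"
    by simp
  moreover have "distinct (as @ [b, z])"
    using mu.prems(2) z(2) by auto
  ultimately show ?case
    using mu.prems(1) z(1) k by - (rule derivable_Mu)
qed

lemma derivable_PGoal:
  assumes "computes h (map val as) (val b)" "length as = 3" "distinct (as @ [b])"
  shows "derivable rs (PGoal, as @ [b])"
proof (rule derivableI[OF base_rules(7), of "as @ [b]"])
  have "derivable rs (PG h (length (map val as)), as @ [b])"
    by (rule derivable_PG[OF assms(1) _ assms(3)]) (use rs assms(2) in \<open>auto simp: program_def\<close>)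
  moreover have "map ((!) (as @ [b])) [0..<4] = as @ [b]"
    using map_nth[of "as @ [b]"] assms(2) by simp
  ultimately show "derivable rs (inst ((!) (as @ [b])) x)" if "x \<in> set [(PG h 3, [0..<4])]" for x
    using that assms(2) by simp
  show "(PGoal, as @ [b]) = inst ((!) (as @ [b])) (PGoal, [0..<4])"
    using map_nth[of "as @ [b]"] assms(2) by simp
qed (use assms in auto)

end

text \<open>The chain is built downwards from an atom of value \<open>t\<close>: predecessors are
  prescribed by \<open>pre\<close>, whereas not every atom need be the predecessor of
  another.\<close>

lemma ex_pre_chain:
  "\<exists>xs. length xs = Suc t \<and> (\<forall>k\<le>t. val (xs ! k) = k) \<and> (\<forall>k<t. xs ! k = pre (xs ! Suc k))"
proof -
  obtain bs where "map val bs = [t]" "distinct bs" "set bs \<inter> {} = {}"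
    using fresh[OF finite.emptyI] .
  then obtain c where c: "val c = t"
    by (auto simp: map_eq_Cons_conv)
  define x where "x k = (pre ^^ (t - k)) c" for k
  have "x k = pre (x (Suc k))" if "k < t" for k
    using that by (simp add: x_def Suc_diff_Suc flip: funpow.simps(2)[unfolded o_def] Suc_diff_Suc)
  moreover have "val (x k) = k" if "k \<le> t" for k
    using that
  proof (induction k rule: inc_induct)
    case base
    show ?case using c by (simp add: x_def)
  next
    case (step k)
    then show ?case using \<open>k < t \<Longrightarrow> x k = pre (x (Suc k))\<close> val_pre by simp
  qed
  ultimately show ?thesis
    by (intro exI[of _ "map x [0..<Suc t]"]) (simp del: upt_Suc)
qed

text \<open>The numbers 1, \<open>a\<close>, \<open>s\<close>, \<open>t\<close> have to differ
  because \<open>PGoal\<close> takes a tuple of four distinct atoms.\<close>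

lemma ex_proof_word:
  assumes "computes h [a, s, t] 1" "distinct [1, a, s, t]" "1 \<le> t" "a \<le> t" "s \<le> t"
  shows "\<exists>xs w. length xs = Suc t \<and> distinct xs \<and> proof_word (program h) w \<and>
    goals a s t xs \<subseteq> head (program h) ` set w"
proof -
  obtain xs where xs: "length xs = Suc t" "\<And>k. k \<le> t \<Longrightarrow> val (xs ! k) = k"
    "\<And>k. k < t \<Longrightarrow> xs ! k = pre (xs ! Suc k)"
    using ex_pre_chain[of t] by blast
  have "distinct xs"
    unfolding distinct_conv_nth using xs(1,2) by (metis less_Suc_eq_le)
  have "derivable (program h) y" if "y \<in> goals a s t xs" for y
  proof -
    from that consider "y = (PZ, [xs ! 0])" | "y = (PGoal, [xs ! a, xs ! s, xs ! t] @ [xs ! 1])"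
      | k where "k < t" "y = (PS, [xs ! k, xs ! Suc k])"
      by (auto simp: goals_def)
    then show ?thesis
    proof cases
      case 1
      then show ?thesis using derivable_PZ[OF order_refl] xs(2) by simp
    next
      case 2
      have "computes h (map val [xs ! a, xs ! s, xs ! t]) (val (xs ! 1))"
        using assms xs(2) by simp
      moreover have "distinct ([xs ! a, xs ! s, xs ! t] @ [xs ! 1])"
        using assms xs(1) \<open>distinct xs\<close> by (simp add: nth_eq_iff_index_eq)
      ultimately show ?thesis
        unfolding 2 by (intro derivable_PGoal[OF order_refl]) simp_all
    next
      case 3
      then show ?thesis
        using derivable_PS[OF order_refl, of "xs ! Suc k" k] xs(2,3) by simp
    qed
  qed
  moreover have "finite (goals a s t xs)"
    by (simp add: goals_def)
  ultimately obtain w where "proof_word (program h) w" "goals a s t xs \<subseteq> head (program h) ` set w"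
    using derivable_finite by blast
  then show ?thesis using xs(1) \<open>distinct xs\<close> by blast
qed

end

text \<open>Atoms are identified with pairs of numbers: the first component is the value, and
  \<open>pre\<close> lowers it while keeping the second.\<close>

lemma ex_numbering: "\<exists>(val :: 'a::atom \<Rightarrow> nat) pre. numbering val pre"
proof -
  obtain e :: "'a \<Rightarrow> nat" where e: "bij e"
    using countableE_infinite[OF countableI_type infinite_UNIV] by metis
  define f where "f = prod_decode \<circ> e"
  have f: "bij f"
    unfolding f_def using e by (intro bij_comp bij_prod_decode)
  define val where "val a = fst (f a)" for a
  define pre where "pre a = inv f (fst (f a) - 1, snd (f a))" for a
  have f_inv: "f (inv f x) = x" for x
    using f by (simp add: bij_is_surj surj_f_inv_f)
  have "numbering val pre"
  proof
    fix n
    have "inj (\<lambda>i. inv f (n, i))"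
      by (rule injI) (metis f_inv prod.inject)
    moreover have "range (\<lambda>i. inv f (n, i)) \<subseteq> {a. val a = n}"
      by (auto simp: val_def f_inv)
    ultimately show "infinite {a. val a = n}"
      by (meson finite_imageD finite_subset infinite_UNIV_nat)
  next
    fix a b m n
    assume "val a = Suc m" "val b = Suc n" "pre a = pre b"
    then have "f a = f b"
      by (metis Suc_inject diff_Suc_1 f_inv pre_def prod.collapse prod.inject val_def)
    then show "a = b" using f by (simp add: bij_is_inj inj_eq)
  qed (simp add: pre_def val_def f_inv)
  then show ?thesis by blast
qed

lemma (in numbering) proof_word_wf:
  "proof_word rs w \<Longrightarrow> justified rs w \<and> (\<forall>x\<in>set w. wf_instance rs x)"
  by (simp add: proof_word_def)

theorem ex_justified:
  assumes "computes h [a, s, t] 1" "distinct [1, a, s, t]" "1 \<le> t" "a \<le> t" "s \<le> t"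
  shows "\<exists>(xs :: 'a::atom list) w. length xs = Suc t \<and> distinct xs \<and> justified (program h) w \<and>
    (\<forall>x\<in>set w. wf_instance (program h) x) \<and> consistent (head (program h) ` set w) \<and>
    goals a s t xs \<subseteq> head (program h) ` set w"
proof -
  obtain val :: "'a \<Rightarrow> nat" and pre where "numbering val pre"
    using ex_numbering by blast
  then interpret numbering val pre .
  show ?thesis
    using ex_proof_word[OF assms] proof_word_wf proof_word_consistent by meson
qed

section \<open>The automaton detecting invalid derivations\<close>

text \<open>\<open>Wait\<close> stores the code of a predicate, not the predicate, so that the
  states with index \<open>8 + i\<close> fill a whole orbit even if \<open>i\<close> codes no
  predicate.\<close>

datatype 'b st =
    Init | Pre | Top | All | Fin | Start | DupZ 'b | DupS 'b 'b | Wait nat "'b list"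

text \<open>\<open>Anchor q\<close> carries the atoms of \<open>q\<close>: states within one orbit
  need different residual words, and all these letters together still form finitely many
  orbits.\<close>

datatype 'b letter = Input "'b list" | End | Rule "'b ground" | Anchor "'b st"

fun enc_st :: "'b st \<Rightarrow> nat \<times> 'b list" where
  "enc_st Init = (0, [])"
| "enc_st Pre = (1, [])"
| "enc_st Top = (2, [])"
| "enc_st All = (3, [])"
| "enc_st Fin = (4, [])"
| "enc_st Start = (5, [])"
| "enc_st (DupZ a) = (6, [a])"
| "enc_st (DupS a b) = (7, [a, b])"
| "enc_st (Wait i as) = (8 + i, as)"

fun enc_letter :: "nat \<Rightarrow> 'b letter \<Rightarrow> nat \<times> 'b list" where
  "enc_letter L (Input xs) = (0, xs)"
| "enc_letter L End = (1, [])"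
| "enc_letter L (Rule (l, \<theta>)) = (2 + l, \<theta>)"
| "enc_letter L (Anchor q) = (2 + L + fst (enc_st q), snd (enc_st q))"

text \<open>
  \<open>Wait\<close> accepts if a fact is not derived in the rest of the word; \<open>DupZ\<close> and \<open>DupS\<close> accept if a
  conflicting definition of an atom follows. The part after an \<open>Input\<close> letter is accepted from
  \<open>Pre\<close> if it is not a derivation of the goals, and from \<open>Top\<close> always.
\<close>

inductive edge :: "rule list \<Rightarrow> 'b st \<Rightarrow> 'b letter \<Rightarrow> 'b st \<Rightarrow> bool" for rs where
  anchor: "q \<noteq> Init \<Longrightarrow> q \<noteq> Top \<Longrightarrow> edge rs Init (Anchor q) q"
| all: "edge rs All (Rule x) All"
| all_end: "edge rs All End Fin"
| start: "edge rs Start (Rule x) Start"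
| unjustified: "(p, as) \<in> body rs x \<Longrightarrow> edge rs Start (Rule x) (Wait (to_nat p) as)"
| start_Z: "head rs x = (PZ, [a]) \<Longrightarrow> edge rs Start (Rule x) (DupZ a)"
| start_S: "head rs x = (PS, [a, b]) \<Longrightarrow> edge rs Start (Rule x) (DupS a b)"
| dupZ: "edge rs (DupZ a) (Rule x) (DupZ a)"
| dupZ_S: "head rs x = (PS, [b, a]) \<Longrightarrow> edge rs (DupZ a) (Rule x) All"
| dupS: "edge rs (DupS a b) (Rule x) (DupS a b)"
| dupS_Z: "head rs x = (PZ, [b]) \<Longrightarrow> edge rs (DupS a b) (Rule x) All"
| dupS_S: "head rs x = (PS, [c, b]) \<Longrightarrow> c \<noteq> a \<Longrightarrow> edge rs (DupS a b) (Rule x) All"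
| wait: "head rs x = (p, bs) \<Longrightarrow> (to_nat p, bs) \<noteq> (i, as) \<Longrightarrow>
    edge rs (Wait i as) (Rule x) (Wait i as)"
| wait_end: "edge rs (Wait i as) End Fin"

inductive input_edge :: "nat \<Rightarrow> nat \<Rightarrow> nat \<Rightarrow> 'b st \<Rightarrow> 'b letter \<Rightarrow> 'b st \<Rightarrow> bool" for a s t where
  top: "input_edge a s t Top (Input xs) All"
| pre: "input_edge a s t Pre (Input xs) Start"
| pre_goal: "(p, as) \<in> goals a s t xs \<Longrightarrow> input_edge a s t Pre (Input xs) (Wait (to_nat p) as)"

definition step :: "rule list \<Rightarrow> nat \<Rightarrow> nat \<Rightarrow> nat \<Rightarrow> 'b st \<Rightarrow> 'b letter \<Rightarrow> 'b st \<Rightarrow> bool" where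
  "step rs a s t p x q \<longleftrightarrow> edge rs p x q \<or> input_edge a s t p x q"

locale encoding =
  fixes rs :: "rule list" and a s t :: nat
begin

primrec acc :: "'b st \<Rightarrow> 'b letter list \<Rightarrow> bool" where
  "acc p [] \<longleftrightarrow> p = Fin"
| "acc p (x # w) \<longleftrightarrow> (\<exists>q. step rs a s t p x q \<and> acc q w)"

lemmas step_simps = step_def edge.simps input_edge.simps

lemma acc_Fin: "acc Fin v \<longleftrightarrow> v = []"
  by (cases v) (auto simp: step_simps)

fun inner :: "'b st \<Rightarrow> bool" where
  "inner Init = False"
| "inner Pre = False"
| "inner Top = False"
| "inner _ = True"

lemma inner_step:
  assumes "inner p" "step rs a s t p x q"
  shows "inner q \<and> (\<exists>y. x = Rule y) \<or> x = End \<and> q = Fin"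
  using assms by (cases p) (auto simp: step_simps)

text \<open>Once past the first phase, a run reads rule letters up to a single \<open>End\<close>.
  In particular it never reads \<open>Input\<close>, which later locates the state in which an
  \<open>Input\<close> letter is read.\<close>

lemma inner_acc: "inner q \<Longrightarrow> acc q v \<Longrightarrow> q = Fin \<and> v = [] \<or> (\<exists>w. v = map Rule w @ [End])"
proof (induction v arbitrary: q)
  case (Cons x v)
  then obtain q' where q': "step rs a s t q x q'" "acc q' v" by auto
  from inner_step[OF Cons.prems(1) q'(1)] show ?case
  proof (elim disjE conjE exE)
    fix y assume "inner q'" and y: "x = Rule y"
    show ?thesis
    proof (cases "q' = Fin")
      case True
      then show ?thesis using q'(1) y Cons.prems(1) by (auto simp: step_simps)
    next
      case False
      with Cons.IH[OF \<open>inner q'\<close> q'(2)] obtain w where "v = map Rule w @ [End]" by blast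
      then show ?thesis
        using y by (intro disjI2 exI[of _ "y # w"]) simp
    qed
  next
    assume "x = End" "q' = Fin"
    then show ?thesis
      using q'(2) acc_Fin by (intro disjI2 exI[of _ "[]"]) auto
  qed
qed simp

abbreviation word :: "'b ground list \<Rightarrow> 'b letter list" where
  "word w \<equiv> map Rule w @ [End]"

lemma acc_All: "acc All (word w)"
  by (induction w) (auto simp: step_simps)

lemma acc_DupZ: "acc (DupZ c) (word w) \<longleftrightarrow> (\<exists>b. (PS, [b, c]) \<in> head rs ` set w)"
proof (induction w)
  case (Cons x w)
  have "acc (DupZ c) (word (x # w)) \<longleftrightarrow>
      acc (DupZ c) (word w) \<or> (\<exists>b. (PS, [b, c]) = head rs x) \<and> acc All (word w)"
    by (simp add: step_simps) metis
  then show ?case unfolding Cons.IH using acc_All by auto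
qed (auto simp: step_simps)

lemma acc_DupS: "acc (DupS b c) (word w) \<longleftrightarrow>
  (PZ, [c]) \<in> head rs ` set w \<or> (\<exists>d. (PS, [d, c]) \<in> head rs ` set w \<and> d \<noteq> b)"
proof (induction w)
  case (Cons x w)
  have "acc (DupS b c) (word (x # w)) \<longleftrightarrow> acc (DupS b c) (word w) \<or>
      ((PZ, [c]) = head rs x \<or> (\<exists>d. (PS, [d, c]) = head rs x \<and> d \<noteq> b)) \<and> acc All (word w)"
    by (simp add: step_simps) metis
  then show ?case unfolding Cons.IH using acc_All by auto
qed (auto simp: step_simps)

lemma acc_Wait: "acc (Wait (to_nat p) as) (word w) \<longleftrightarrow> (p, as) \<notin> head rs ` set w"
proof (induction w)
  case Nil
  then show ?case by (auto simp: step_simps)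
next
  case (Cons x w)
  have "acc (Wait (to_nat p) as) (word (x # w)) \<longleftrightarrow>
      head rs x \<noteq> (p, as) \<and> acc (Wait (to_nat p) as) (word w)"
    by (cases "head rs x") (auto simp: step_simps)
  then show ?case using Cons by auto
qed

text \<open>The first argument is always the \<open>PS\<close> fact, but a word may contain the two
  facts in either order; hence both directions in \<open>consistent_insert\<close>, and both kinds
  of states \<open>DupZ\<close> and \<open>DupS\<close>.\<close>

definition clash :: "'b fact \<Rightarrow> 'b fact \<Rightarrow> bool" where
  "clash x y \<longleftrightarrow>
     (\<exists>b c. x = (PS, [b, c]) \<and> (y = (PZ, [c]) \<or> (\<exists>d. y = (PS, [d, c]) \<and> d \<noteq> b)))"

lemma consistent_clash: "consistent F \<longleftrightarrow> (\<forall>x\<in>F. \<forall>y\<in>F. \<not> clash x y)"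
  unfolding consistent_def clash_def by blast

lemma consistent_insert:
  "consistent (insert x F) \<longleftrightarrow> consistent F \<and> (\<forall>y\<in>F. \<not> clash x y \<and> \<not> clash y x)"
proof -
  have "\<not> clash x x" by (auto simp: clash_def)
  then show ?thesis unfolding consistent_clash by blast
qed

lemma clash_cases:
  "(\<exists>y\<in>F. clash x y \<or> clash y x) \<longleftrightarrow>
     (\<exists>c. x = (PZ, [c]) \<and> (\<exists>b. (PS, [b, c]) \<in> F)) \<or>
     (\<exists>b c. x = (PS, [b, c]) \<and> ((PZ, [c]) \<in> F \<or> (\<exists>d. (PS, [d, c]) \<in> F \<and> d \<noteq> b)))"
  unfolding clash_def by blast

text \<open>A run stays in \<open>Start\<close> until it guesses the letter at fault: one with a
  premise missing from the rest, or the earlier of two conflicting definitions. \<open>Start\<close>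
  has no edge for \<open>End\<close>, so a flawless word is rejected.\<close>

lemma acc_Start:
  "acc Start (word w) \<longleftrightarrow> \<not> (justified rs w \<and> consistent (head rs ` set w))"
proof (induction w)
  case Nil
  then show ?case by (auto simp: step_simps consistent_def)
next
  case (Cons x w)
  have "acc Start (word (x # w)) \<longleftrightarrow> acc Start (word w) \<or>
      (\<exists>p as. (p, as) \<in> body rs x \<and> acc (Wait (to_nat p) as) (word w)) \<or>
      (\<exists>c. head rs x = (PZ, [c]) \<and> acc (DupZ c) (word w)) \<or>
      (\<exists>b c. head rs x = (PS, [b, c]) \<and> acc (DupS b c) (word w))"
    by (simp add: step_simps) blast
  also have "\<dots> \<longleftrightarrow> acc Start (word w) \<or> \<not> body rs x \<subseteq> head rs ` set w \<or>
      (\<exists>y\<in>head rs ` set w. clash (head rs x) y \<or> clash y (head rs x))"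
  proof -
    have "\<not> body rs x \<subseteq> head rs ` set w \<longleftrightarrow>
        (\<exists>p as. (p, as) \<in> body rs x \<and> (p, as) \<notin> head rs ` set w)"
      by auto
    then show ?thesis
      unfolding acc_Wait acc_DupZ acc_DupS clash_cases by blast
  qed
  finally show ?case
    unfolding Cons.IH by (simp add: consistent_insert) blast
qed

definition valid :: "'b list \<Rightarrow> 'b ground list \<Rightarrow> bool" where
  "valid xs w \<longleftrightarrow> justified rs w \<and> consistent (head rs ` set w) \<and>
     goals a s t xs \<subseteq> head rs ` set w"

lemma acc_Top: "acc Top v \<longleftrightarrow> (\<exists>xs w. v = Input xs # word w)"
proof
  assume "acc Top v"
  then obtain xs v' where v: "v = Input xs # v'" "acc All v'"
    by (cases v) (auto simp: step_simps)
  then show "\<exists>xs w. v = Input xs # word w"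
    using inner_acc[of All v'] by auto
qed (use acc_All in \<open>auto simp: step_simps\<close>)

lemma acc_Pre: "acc Pre v \<longleftrightarrow> (\<exists>xs w. v = Input xs # word w \<and> \<not> valid xs w)"
proof -
  have *: "acc Pre (Input xs # v) \<longleftrightarrow> acc Start v \<or>
      (\<exists>p as. (p, as) \<in> goals a s t xs \<and> acc (Wait (to_nat p) as) v)" for xs v
    by (auto simp: step_simps)
  have "acc Pre (Input xs # word w) \<longleftrightarrow> \<not> valid xs w" for xs w
    unfolding * acc_Start acc_Wait valid_def by auto
  moreover have "\<exists>xs w. v = Input xs # word w" if "acc Pre v"
  proof -
    from that obtain x v' q where v: "v = x # v'" "step rs a s t Pre x q" "acc q v'"
      by (cases v) auto
    then obtain xs where "x = Input xs" "inner q" "q \<noteq> Fin"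
      by (auto simp: step_simps)
    then show ?thesis
      using v inner_acc by blast
  qed
  ultimately show ?thesis by blast
qed

lemma acc_Init: "acc Init v \<longleftrightarrow> (\<exists>q v'. v = Anchor q # v' \<and> q \<noteq> Init \<and> q \<noteq> Top \<and> acc q v')"
  by (cases v) (auto simp: step_simps)

text \<open>No anchor leads to \<open>Top\<close>, inner states never read \<open>Input\<close>, and
  any step from \<open>Pre\<close> enters an inner state. So \<open>u\<close> can only be the letter
  \<open>Anchor Pre\<close>. Hence \<open>Top\<close> has no way to be residual except through the
  language of \<open>Pre\<close>.\<close>

lemma acc_Init_append_Input:
  assumes "acc Init (u @ Input xs # v)"
  shows "acc Pre (Input xs # v)"
proof -
  have no_inner: "\<not> acc q (u @ Input xs # v)" if "inner q" for q u
  proof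
    assume "acc q (u @ Input xs # v)"
    with inner_acc[OF that this] obtain w where "u @ Input xs # v = word w"
      by blast
    then have "Input xs \<in> set (word w)"
      by (metis in_set_conv_decomp)
    then show False by auto
  qed
  from assms obtain q u' where u: "u = Anchor q # u'" "q \<noteq> Init" "q \<noteq> Top" "acc q (u' @ Input xs # v)"
    unfolding acc_Init by (cases u) auto
  then have q: "q = Pre"
    using no_inner by (cases q) auto
  have "u' = []"
  proof (cases u')
    case (Cons x u'')
    with u q obtain q' where "step rs a s t Pre x q'" "acc q' (u'' @ Input xs # v)" by auto
    moreover from this have "inner q'" by (auto simp: step_simps)
    ultimately show ?thesis using no_inner by blast
  qed
  with u q show ?thesis by simp
qed

end


section \<open>Orbits of plain tuples, and the encoding of states and letters\<close>

definition orbits :: "nat list \<Rightarrow> orbit_rep list" where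
  "orbits ds = map (\<lambda>k. (k, [[0..<k]])) ds"

lemma wf_orbit_orbits: "\<forall>r\<in>set (orbits ds). wf_orbit r"
proof -
  have "map ((!) [0..<k]) [0..<k] = [0..<k]" for k
    using map_nth[of "[0..<k]"] by simp
  then show ?thesis
    by (auto simp: orbits_def wf_orbit_def permutations_of_set_def)
qed

lemma wf_tuple_orbits:
  "wf_tuple (orbits ds) (i, xs) \<longleftrightarrow> i < length ds \<and> length xs = ds ! i \<and> distinct xs"
  by (auto simp: wf_tuple_def orbits_def)

text \<open>\<open>orbits\<close> uses only trivial groups of coordinate permutations, so the class
  of a tuple is a singleton.\<close>

definition single :: "nat \<times> 'b list \<Rightarrow> nat \<times> 'b list set" where
  "single = map_prod id (\<lambda>xs. {xs})"

lemma single_inj: "single u = single v \<Longrightarrow> u = v"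
  by (cases u; cases v) (simp add: single_def)

lemma fst_single [simp]: "fst (single u) = fst u"
  by (simp add: single_def)

lemma element_orbits:
  assumes "wf_tuple (orbits ds) u"
  shows "element (orbits ds) u = single u"
proof -
  obtain i xs where u: "u = (i, xs)" by fastforce
  with assms have i: "i < length ds" "length xs = ds ! i"
    by (simp_all add: wf_tuple_orbits)
  then show ?thesis
    using map_nth[of xs] by (simp add: u element_def orbits_def single_def)
qed

lemma elements_orbits: "elements (orbits ds) = single ` {u. wf_tuple (orbits ds) u}"
  unfolding elements_def by (rule image_cong) (simp_all add: element_orbits)

definition st_dims :: "nat \<Rightarrow> nat list" where
  "st_dims N = [0, 0, 0, 0, 0, 0, 1, 2] @ map (\<lambda>i. arity (from_nat i)) [0..<N]"

text \<open>The orbits of \<open>End\<close>, of the rules, and of one anchor per state. The orbit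
  of \<open>Input\<close> is left out because it alone depends on \<open>t\<close>; it is put in
  front as dimension \<open>n\<close>.\<close>

definition letter_dims :: "rule list \<Rightarrow> nat \<Rightarrow> nat list" where
  "letter_dims rs N = 0 # map fst rs @ st_dims N"

definition wf_st :: "nat \<Rightarrow> 'b st \<Rightarrow> bool" where
  "wf_st N q \<longleftrightarrow> wf_tuple (orbits (st_dims N)) (enc_st q)"

text \<open>The second conjunct excludes rule indices beyond the program, whose codes would collide
  with those of anchors. The dimension \<open>n\<close> is \<open>Suc t\<close> in the automaton and
  0 for the fixed transitions, which contain no \<open>Input\<close> letter.\<close>

definition wf_letter :: "rule list \<Rightarrow> nat \<Rightarrow> nat \<Rightarrow> 'b letter \<Rightarrow> bool" where
  "wf_letter rs N n x \<longleftrightarrow>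
     wf_tuple (orbits (n # letter_dims rs N)) (enc_letter (length rs) x) \<and>
     (\<forall>y. x = Rule y \<longrightarrow> fst y < length rs)"

lemma wf_st_simps [simp]:
  "wf_st N Init" "wf_st N Pre" "wf_st N Top" "wf_st N All" "wf_st N Fin" "wf_st N Start"
  "wf_st N (DupZ a)" "wf_st N (DupS a b) \<longleftrightarrow> a \<noteq> b"
  "wf_st N (Wait i as) \<longleftrightarrow> i < N \<and> length as = arity (from_nat i) \<and> distinct as"
  by (auto simp: wf_st_def wf_tuple_orbits st_dims_def nth_append)

lemma wf_letter_simps [simp]:
  "wf_letter rs N n (Input xs) \<longleftrightarrow> length xs = n \<and> distinct xs"
  "wf_letter rs N n End"
  "wf_letter rs N n (Rule x) \<longleftrightarrow> wf_instance rs x"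
  "wf_letter rs N n (Anchor q) \<longleftrightarrow> wf_st N q"
proof -
  show "wf_letter rs N n (Rule x) \<longleftrightarrow> wf_instance rs x"
    by (cases x) (auto simp: wf_letter_def letter_dims_def wf_tuple_orbits nth_append wf_instance_def)
  show "wf_letter rs N n (Anchor q) \<longleftrightarrow> wf_st N q"
    by (cases "enc_st q") (simp add: wf_letter_def letter_dims_def wf_tuple_orbits nth_append wf_st_def)
qed (simp_all add: wf_letter_def letter_dims_def wf_tuple_orbits)

lemma enc_st_inj: "enc_st p = enc_st q \<Longrightarrow> p = q"
  by (cases p; cases q) auto

lemma enc_st_surj:
  assumes "wf_tuple (orbits (st_dims N)) u"
  shows "\<exists>q. enc_st q = u"
proof -
  obtain i xs where u: "u = (i, xs)" by fastforce
  have len: "length xs = st_dims N ! i"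
    using assms u by (simp add: wf_tuple_orbits)
  consider "i \<in> {0, 1, 2, 3, 4, 5}" | "i = 6" | "i = 7" | "8 \<le> i"
    by force
  then show ?thesis
  proof cases
    case 1
    then have "xs = []" using len by (auto simp: st_dims_def)
    with 1 show ?thesis
      unfolding u by (elim insertE emptyE) (metis enc_st.simps)+
  next
    case 2
    then obtain a where "enc_st (DupZ a) = u"
      using len u by (auto simp: st_dims_def length_Suc_conv)
    then show ?thesis ..
  next
    case 3
    then obtain a b where "enc_st (DupS a b) = u"
      using len u by (auto simp: st_dims_def length_Suc_conv numeral_2_eq_2)
    then show ?thesis ..
  next
    case 4
    then have "enc_st (Wait (i - 8) xs) = u" using u by simp
    then show ?thesis ..
  qed
qed

lemma enc_letter_inj:
  assumes "wf_letter rs N n x" "wf_letter rs N n y" "enc_letter (length rs) x = enc_letter (length rs) y"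
  shows "x = y"
  using assms by (cases x; cases y) (auto simp: wf_instance_def intro: enc_st_inj prod_eqI)

lemma enc_letter_surj:
  assumes "wf_tuple (orbits (n # letter_dims rs N)) u"
  shows "\<exists>x. wf_letter rs N n x \<and> enc_letter (length rs) x = u"
proof -
  obtain i xs where u: "u = (i, xs)" by fastforce
  consider "i = 0" | "i = 1" | l where "i = 2 + l" "l < length rs"
    | j where "i = 2 + length rs + j"
  proof (cases "i < 2 + length rs")
    case True
    then have "i = 0 \<or> i = 1 \<or> i = 2 + (i - 2) \<and> i - 2 < length rs" by linarith
    then show ?thesis using that(1-3) by blast
  next
    case False
    then show ?thesis using that(4)[of "i - (2 + length rs)"] by simp
  qed
  then have "\<exists>x. enc_letter (length rs) x = u \<and> (\<forall>y. x = Rule y \<longrightarrow> fst y < length rs)"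
  proof cases
    case 1
    then show ?thesis using u by (intro exI[of _ "Input xs"]) simp
  next
    case 2
    with assms u show ?thesis
      by (intro exI[of _ End]) (simp add: wf_tuple_orbits letter_dims_def)
  next
    case (3 l)
    then show ?thesis using u by (intro exI[of _ "Rule (l, xs)"]) simp
  next
    case (4 j)
    with assms u have "wf_tuple (orbits (st_dims N)) (j, xs)"
      by (simp add: wf_tuple_orbits letter_dims_def nth_append)
    then obtain q where "enc_st q = (j, xs)" using enc_st_surj by blast
    then show ?thesis using u 4 by (intro exI[of _ "Anchor q"]) simp
  qed
  then show ?thesis using assms by (auto simp: wf_letter_def)
qed

lemma enc_st_map: "enc_st (map_st f q) = map_prod id (map f) (enc_st q)"
  by (cases q) simp_all

lemma enc_letter_map: "enc_letter L (map_letter f x) = map_prod id (map f) (enc_letter L x)"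
  by (cases x) (auto simp: enc_st_map)

lemma inst_rename:
  assumes "wf_rule (m, h, b)" "length \<theta> = m" "y \<in> set (h # b)"
  shows "inst ((!) (map f \<theta>)) y = map_prod id (map f) (inst ((!) \<theta>) y)"
  using assms by (cases y) (fastforce simp: wf_rule_def subset_iff)

lemma head_rename:
  assumes "wf_instance rs x" "\<forall>r\<in>set rs. wf_rule r"
  shows "head rs (map_prod id (map f) x) = map_prod id (map f) (head rs x)"
    and "body rs (map_prod id (map f) x) = map_prod id (map f) ` body rs x"
proof -
  obtain l \<theta> where x: "x = (l, \<theta>)" by fastforce
  obtain m h b where r: "rs ! l = (m, h, b)" by (metis prod_cases3)
  have "wf_rule (m, h, b)" "length \<theta> = m"
    using assms r x by (auto simp: wf_instance_def dest: bspec[OF _ nth_mem])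
  note rename = inst_rename[OF this]
  show "head rs (map_prod id (map f) x) = map_prod id (map f) (head rs x)"
    using rename[of h] by (simp add: head_def x r)
  show "body rs (map_prod id (map f) x) = map_prod id (map f) ` body rs x"
  proof -
    have "body rs (map_prod id (map f) x) = inst ((!) (map f \<theta>)) ` set b"
      by (simp add: body_def x r)
    also have "\<dots> = map_prod id (map f) ` inst ((!) \<theta>) ` set b"
      unfolding image_image by (rule image_cong[OF refl], rule rename) simp
    finally show ?thesis
      by (simp add: body_def x r)
  qed
qed

text \<open>Injectivity enters at the two inequalities of \<open>edge\<close>, in
  \<open>dupS_S\<close> and \<open>wait\<close>; the other cases only move names along.\<close>

lemma edge_rename:
  assumes "edge rs p x q" "inj f" "\<forall>r\<in>set rs. wf_rule r" "\<And>y. x = Rule y \<Longrightarrow> wf_instance rs y"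
  shows "edge rs (map_st f p) (map_letter f x) (map_st f q)"
proof -
  have head: "head rs (map_prod id (map f) y) = (r, map f as)"
    if "x = Rule y" "head rs y = (r, as)" for y r as
    using that assms(3,4) by (simp add: head_rename)
  show ?thesis
    using assms(1)
  proof cases
    case anchor
    then have "map_st f q \<noteq> Init" "map_st f q \<noteq> Top" by (cases q; simp)+
    with anchor show ?thesis by (simp add: edge.anchor)
  next
    case (unjustified r as y)
    then have "(r, map f as) \<in> map_prod id (map f) ` body rs y"
      by force
    then have "(r, map f as) \<in> body rs (map_prod id (map f) y)"
      using unjustified(2) assms(3,4) by (simp add: head_rename)
    with unjustified show ?thesis by (simp add: edge.unjustified)
  next
    case (start_Z y c)
    with head show ?thesis by (simp add: edge.start_Z)
  next
    case (start_S y b c)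
    with head show ?thesis by (simp add: edge.start_S)
  next
    case (dupZ_S y b c)
    with head[of y PS "[b, c]"] show ?thesis by (simp add: edge.dupZ_S)
  next
    case (dupS_Z y c b)
    with head show ?thesis by (simp add: edge.dupS_Z)
  next
    case (dupS_S y d c b)
    have "f d \<noteq> f b" using dupS_S assms(2) by (simp add: inj_eq)
    with dupS_S head[of y PS "[d, c]"] show ?thesis by (simp add: edge.dupS_S)
  next
    case (wait y r bs i as)
    have "(to_nat r, map f bs) \<noteq> (i, map f as)"
      using wait(5) assms(2) by (auto dest: map_injective)
    with wait head[of y r bs] show ?thesis by (simp add: edge.wait)
  qed (simp_all add: edge.intros)
qed

text \<open>A bijection between all names and all atoms, not just a map on \<open>xs\<close>: its
  inverse turns a whole transition over atoms into one over natural numbers.\<close>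

lemma ex_renaming:
  assumes "distinct xs"
  shows "\<exists>\<rho> :: nat \<Rightarrow> 'a::atom. bij \<rho> \<and> map \<rho> [0..<length xs] = xs"
proof -
  obtain e :: "'a \<Rightarrow> nat" where e: "bij e"
    using countableE_infinite[OF countableI_type infinite_UNIV] by metis
  have "distinct (map (inv e) [0..<length xs])"
    using e by (simp add: distinct_map bij_imp_bij_inv bij_is_inj inj_on_subset[OF _ subset_UNIV])
  then obtain \<pi> where \<pi>: "map (apply \<pi>) (map (inv e) [0..<length xs]) = xs"
    using ex_perm_map[of "map (inv e) [0..<length xs]" xs] assms by auto
  have "bij (apply \<pi> \<circ> inv e)"
    using e by (intro bij_comp bij_imp_bij_inv) simp_all
  with \<pi> show ?thesis by (intro exI[of _ "apply \<pi> \<circ> inv e"]) simp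
qed

section \<open>Its finite representation\<close>

lemma input_edge_rename:
  assumes "input_edge a s t p (Input xs) q" "length xs = Suc t" "1 \<le> t" "a \<le> t" "s \<le> t"
  shows "input_edge a s t (map_st f p) (Input (map f xs)) (map_st f q)"
  using assms(1)
proof cases
  case (pre_goal r as)
  then have "(r, map f as) \<in> goals a s t (map f xs)"
    using assms(2-5) by (auto simp: goals_def)
  with pre_goal show ?thesis by (simp add: input_edge.pre_goal)
qed (simp_all add: input_edge.intros)

lemma not_edge_Input: "\<not> edge rs p (Input xs) q"
  by (auto elim: edge.cases)

lemma input_edge_Input: "input_edge a s t p x q \<Longrightarrow> \<exists>xs. x = Input xs"
  by (auto elim: input_edge.cases)

text \<open>The chain is listed downwards because a primitive recursion over \<open>k\<close> puts
  the transition for \<open>k\<close> in front of those already produced.\<close>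

definition input_transitions ::
    "nat \<Rightarrow> nat \<Rightarrow> nat \<Rightarrow> ((nat \<times> nat list) \<times> (nat \<times> nat list) \<times> (nat \<times> nat list)) list"
  where
  "input_transitions a s t =
     [((2, []), (0, [0..<Suc t]), (3, [])),
      ((1, []), (0, [0..<Suc t]), (5, [])),
      ((1, []), (0, [0..<Suc t]), (8 + to_nat PZ, [0])),
      ((1, []), (0, [0..<Suc t]), (8 + to_nat PGoal, [a, s, t, 1]))] @
     map (\<lambda>k. ((1, []), (0, [0..<Suc t]), (8 + to_nat PS, [k, Suc k]))) (rev [0..<t])"

lemma set_input_transitions:
  assumes "1 \<le> t" "a \<le> t" "s \<le> t"
  shows "u \<in> set (input_transitions a s t) \<longleftrightarrow>
    (\<exists>p q. input_edge a s t p (Input [0..<Suc t]) q \<and>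
       u = (enc_st p, (0, [0..<Suc t]), enc_st q))"
proof -
  have goals: "goals a s t [0..<Suc t] =
      {(PZ, [0]), (PGoal, [a, s, t, 1])} \<union> (\<lambda>k. (PS, [k, Suc k])) ` {..<t}"
    using assms by (auto simp: goals_def nth_append simp del: upt_Suc)
  have edges: "input_edge a s t p (Input xs) q \<longleftrightarrow> p = Top \<and> q = All \<or> p = Pre \<and> q = Start \<or>
      (\<exists>r as. (r, as) \<in> goals a s t xs \<and> p = Pre \<and> q = Wait (to_nat r) as)"
    for p q :: "nat st" and xs
    by (simp add: input_edge.simps) metis
  define U where "U = [0..<Suc t]"
  have "(\<exists>p q. input_edge a s t p (Input U) q \<and> u = (enc_st p, (0, U), enc_st q))
    \<longleftrightarrow> u = ((2, []), (0, U), (3, [])) \<or> u = ((1, []), (0, U), (5, [])) \<or>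
      (\<exists>r as. (r, as) \<in> goals a s t U \<and> u = ((1, []), (0, U), (8 + to_nat r, as)))"
    unfolding edges conj_disj_distribR ex_disj_distrib
    by (intro arg_cong2[where f = "(\<or>)"]) (simp, simp, metis enc_st.simps(2,9))
  also have "\<dots> \<longleftrightarrow> u \<in> set (input_transitions a s t)"
    unfolding input_transitions_def U_def[symmetric] goals[folded U_def] by auto
  finally show ?thesis unfolding U_def by simp
qed

text \<open>
  The bound on the names is the maximal number of atoms in a state, a letter and a state together,
  so that every transition is an instance of a representative.
\<close>

definition static_transitions ::
    "rule list \<Rightarrow> nat \<Rightarrow> ((nat \<times> nat list) \<times> (nat \<times> nat list) \<times> (nat \<times> nat list)) set"
  where
  "static_transitions rs N =
     {(enc_st p, enc_letter (length rs) x, enc_st q) | p x q.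
        edge rs p x q \<and> wf_st N p \<and> wf_letter rs N 0 x \<and> wf_st N q \<and>
        set (snd (enc_st p) @ snd (enc_letter (length rs) x) @ snd (enc_st q))
          \<subseteq> {..<3 * sum_list (letter_dims rs N)}}"

lemma finite_tuples:
  fixes B :: nat
  shows "finite {u. wf_tuple (orbits ds) u \<and> set (snd u) \<subseteq> {..<B}}"
proof (rule finite_subset)
  show "{u. wf_tuple (orbits ds) u \<and> set (snd u) \<subseteq> {..<B}} \<subseteq>
      {..<length ds} \<times> {xs. set xs \<subseteq> {..<B} \<and> distinct xs}"
    by (auto simp: wf_tuple_orbits)
  show "finite ({..<length ds} \<times> {xs. set xs \<subseteq> {..<B} \<and> distinct xs})"
    by (intro finite_cartesian_product finite_subset_distinct) simp_all
qed

lemma finite_static_transitions: "finite (static_transitions rs N)"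
proof (rule finite_subset)
  let ?U = "\<lambda>ds. {u. wf_tuple (orbits ds) u \<and> set (snd u) \<subseteq> {..<3 * sum_list (letter_dims rs N)}}"
  show "static_transitions rs N \<subseteq> ?U (st_dims N) \<times> ?U (0 # letter_dims rs N) \<times> ?U (st_dims N)"
    by (auto simp: static_transitions_def wf_st_def wf_letter_def)
  show "finite (?U (st_dims N) \<times> ?U (0 # letter_dims rs N) \<times> ?U (st_dims N))"
    by (intro finite_cartesian_product finite_tuples)
qed

text \<open>The sum of all dimensions is a crude bound for each of them; those of the states occur
  in it through the anchors.\<close>

lemma length_enc_st: "wf_st N q \<Longrightarrow> length (snd (enc_st q)) \<le> sum_list (letter_dims rs N)"
proof -
  assume "wf_st N q"
  then have "length (snd (enc_st q)) \<in> set (letter_dims rs N)"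
    by (cases "enc_st q") (auto simp: wf_st_def wf_tuple_orbits letter_dims_def)
  then show ?thesis by (rule member_le_sum_list) simp
qed

lemma length_enc_letter:
  assumes "wf_letter rs N n x" "\<And>xs. x \<noteq> Input xs"
  shows "length (snd (enc_letter (length rs) x)) \<le> sum_list (letter_dims rs N)"
proof -
  obtain i xs where e: "enc_letter (length rs) x = (i, xs)" by fastforce
  have "i \<noteq> 0" using assms(2) e by (cases x) auto
  then have "length (snd (enc_letter (length rs) x)) \<in> set (letter_dims rs N)"
    using assms(1) e by (cases i) (auto simp: wf_letter_def wf_tuple_orbits)
  then show ?thesis by (rule member_le_sum_list) simp
qed

definition bounded_preds :: "nat \<Rightarrow> rule list \<Rightarrow> bool" where
  "bounded_preds N rs \<longleftrightarrow> to_nat PZ < N \<and> to_nat PS < N \<and> to_nat PGoal < N \<and>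
     (\<forall>(m, h, b)\<in>set rs. \<forall>y\<in>set (h # b). to_nat (fst y) < N)"

lemma ex_bounded_preds: "\<exists>N. bounded_preds N rs"
proof -
  let ?P = "{PZ, PS, PGoal} \<union> (\<Union>(m, h, b)\<in>set rs. fst ` set (h # b))"
  have "finite ?P" by auto
  then obtain N where "\<forall>p\<in>?P. to_nat p < N"
    using finite_nat_set_iff_bounded[of "to_nat ` ?P"] by auto
  then have "bounded_preds N rs"
    unfolding bounded_preds_def by fastforce
  then show ?thesis ..
qed

text \<open>Arranged so that the fixed parts are suffixes or entire lists:
  \<open>letter_dims\<close>, \<open>st_dims\<close> and \<open>T\<close> enter the code unchanged,
  and only list heads computed from \<open>a\<close>, \<open>s\<close>, \<open>t\<close> are
  added.\<close>

definition machine_rep :: "rule list \<Rightarrow> nat \<Rightarrow> nat \<Rightarrow> nat \<Rightarrow> nat \<Rightarrow>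
    ((nat \<times> nat list) \<times> (nat \<times> nat list) \<times> (nat \<times> nat list)) list \<Rightarrow> nfa_rep" where
  "machine_rep rs N a s t T =
     \<lparr>alphabet_rep = orbits (Suc t # letter_dims rs N),
      states_rep = orbits (st_dims N),
      initial_rep = [0],
      final_rep = [4],
      transitions_rep = input_transitions a s t @ T\<rparr>"

locale machine = encoding +
  fixes N T
  assumes wf_rules: "\<forall>r\<in>set rs. wf_rule r"
    and bounded: "bounded_preds N rs"
    and input: "distinct [1, a, s, t]" "1 \<le> t" "a \<le> t" "s \<le> t"
    and T: "set T = static_transitions rs N"
begin

abbreviation "R \<equiv> machine_rep rs N a s t T"

abbreviation letter_ok :: "'b letter \<Rightarrow> bool" where
  "letter_ok \<equiv> wf_letter rs N (Suc t)"

lemma inst_bounded: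
  assumes "wf_instance rs x" "y \<in> insert (head rs x) (body rs x)"
  shows "to_nat (fst y) < N"
proof -
  obtain l \<theta> where x: "x = (l, \<theta>)" by fastforce
  obtain m h b where r: "rs ! l = (m, h, b)" by (metis prod_cases3)
  then have "(m, h, b) \<in> set rs"
    using assms(1) x by (auto simp: wf_instance_def dest: nth_mem)
  then have "\<forall>z\<in>set (h # b). to_nat (fst z) < N"
    using bounded by (auto simp: bounded_preds_def)
  then show ?thesis
    using assms(2) x r by (auto simp: head_def body_def inst_def)
qed

lemma step_wf:
  assumes "step rs a s t p x q" "letter_ok x" "wf_st N p"
  shows "wf_st N q"
  using assms(1) unfolding step_def
proof
  assume "edge rs p x q"
  then show ?thesis
  proof cases
    case (unjustified r as y)
    then show ?thesis
      using inst_wf[OF _ wf_rules, of y "(r, as)"] inst_bounded[of y "(r, as)"] assms(2) by simp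
  next
    case (start_S y b c)
    then show ?thesis
      using inst_wf(2)[OF _ wf_rules, of y "(PS, [b, c])"] assms(2) by simp
  qed (use assms(2,3) in simp_all)
next
  assume "input_edge a s t p x q"
  then show ?thesis
  proof cases
    case (pre_goal r as xs)
    then have xs: "length xs = Suc t" "distinct xs"
      using assms(2) by simp_all
    \<comment> \<open>Distinctness of 1, \<open>a\<close>, \<open>s\<close>, \<open>t\<close> makes
      the goal tuple a legitimate tuple of a \<open>Wait\<close> state.\<close>
    have "distinct as \<and> length as = arity r \<and> to_nat r < N"
      using pre_goal(4) xs input bounded
      by (auto simp: goals_def bounded_preds_def nth_eq_iff_index_eq)
    then show ?thesis using pre_goal by simp
  qed simp_all
qed

lemma step_rename:
  assumes "step rs a s t p x q" "inj f" "letter_ok x"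
  shows "step rs a s t (map_st f p) (map_letter f x) (map_st f q)"
  using assms(1) unfolding step_def
proof
  assume e: "edge rs p x q"
  have "edge rs (map_st f p) (map_letter f x) (map_st f q)"
    by (rule edge_rename[OF e assms(2) wf_rules]) (use assms(3) in simp)
  then show "edge rs (map_st f p) (map_letter f x) (map_st f q) \<or>
    input_edge a s t (map_st f p) (map_letter f x) (map_st f q)" ..
next
  assume e: "input_edge a s t p x q"
  then obtain xs where x: "x = Input xs"
    using input_edge_Input by blast
  with e assms(3) input have "input_edge a s t (map_st f p) (Input (map f xs)) (map_st f q)"
    by (intro input_edge_rename) simp_all
  with x show "edge rs (map_st f p) (map_letter f x) (map_st f q) \<or>
    input_edge a s t (map_st f p) (map_letter f x) (map_st f q)"
    by simp
qed

lemma wf_st_rename: "inj f \<Longrightarrow> wf_st N q \<Longrightarrow> wf_st N (map_st f q)"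
  unfolding wf_st_def enc_st_map by (rule wf_tuple_map)

lemma letter_ok_rename: "inj f \<Longrightarrow> letter_ok x \<Longrightarrow> letter_ok (map_letter f x)"
  unfolding wf_letter_def enc_letter_map
  by (cases x) (auto dest: wf_tuple_map)

lemma rep_sound:
  assumes "u \<in> set (transitions_rep R)"
  shows "\<exists>p x q. step rs a s t p x q \<and> wf_st N p \<and> letter_ok x \<and> wf_st N q \<and>
    u = (enc_st p, enc_letter (length rs) x, enc_st q)"
proof -
  from assms consider "u \<in> set (input_transitions a s t)" | "u \<in> static_transitions rs N"
    by (auto simp: machine_rep_def T)
  then show ?thesis
  proof cases
    case 1
    then obtain p q where e: "input_edge a s t p (Input [0..<Suc t]) q"
      and u: "u = (enc_st p, (0, [0..<Suc t]), enc_st q)"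
      unfolding set_input_transitions[OF input(2-4)] by blast
    have p: "wf_st N p" using e by cases simp_all
    have step: "step rs a s t p (Input [0..<Suc t]) q"
      using e by (simp add: step_def)
    have x: "letter_ok (Input [0..<Suc t])"
      by (simp del: upt_Suc)
    note step x p step_wf[OF step x p]
    moreover have "u = (enc_st p, enc_letter (length rs) (Input [0..<Suc t]), enc_st q)"
      using u by simp
    ultimately show ?thesis by blast
  next
    case 2
    then obtain p x q where e: "edge rs p x q" "wf_st N p" "wf_letter rs N 0 x" "wf_st N q"
      and u: "u = (enc_st p, enc_letter (length rs) x, enc_st q)"
      unfolding static_transitions_def by blast
    have "letter_ok x"
      using e(1,3) by (cases x) (auto simp: not_edge_Input)
    moreover have "step rs a s t p x q"
      using e by (simp add: step_def)
    ultimately show ?thesis using e u by blast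
  qed
qed

lemma rep_complete:
  assumes "step rs a s t p x q" "wf_st N p" "letter_ok x" "wf_st N q"
    and "\<And>xs. x = Input xs \<Longrightarrow> xs = [0..<Suc t]"
    and "edge rs p x q \<Longrightarrow> set (snd (enc_st p) @ snd (enc_letter (length rs) x) @ snd (enc_st q))
          \<subseteq> {..<3 * sum_list (letter_dims rs N)}"
  shows "(enc_st p, enc_letter (length rs) x, enc_st q) \<in> set (transitions_rep R)"
  using assms(1) unfolding step_def
proof
  assume e: "edge rs p x q"
  then have "wf_letter rs N 0 x"
    using assms(3) by (cases x) (auto simp: not_edge_Input)
  then have "(enc_st p, enc_letter (length rs) x, enc_st q) \<in> static_transitions rs N"
    unfolding static_transitions_def using e assms by blast
  then show ?thesis by (simp add: machine_rep_def T)
next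
  assume e: "input_edge a s t p x q"
  with assms(5) have x: "x = Input [0..<Suc t]"
    using input_edge_Input by blast
  then have "(enc_st p, enc_letter (length rs) x, enc_st q) \<in> set (input_transitions a s t)"
    unfolding set_input_transitions[OF input(2-4)] using e by force
  then show ?thesis by (simp add: machine_rep_def)
qed

lemma wf_R: "wf_nfa_rep R"
proof -
  have "\<forall>(p, x, q)\<in>set (transitions_rep R). wf_tuple (states_rep R) p \<and>
      wf_tuple (alphabet_rep R) x \<and> wf_tuple (states_rep R) q"
  proof (clarify del: conjI)
    fix i as j bs k cs
    assume "((i, as), (j, bs), (k, cs)) \<in> set (transitions_rep R)"
    from rep_sound[OF this] show "wf_tuple (states_rep R) (i, as) \<and>
      wf_tuple (alphabet_rep R) (j, bs) \<and> wf_tuple (states_rep R) (k, cs)"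
      by (auto simp: machine_rep_def wf_st_def wf_letter_def)
  qed
  moreover have "0 < length (orbits (st_dims N))" "4 < length (orbits (st_dims N))"
    by (simp_all add: orbits_def st_dims_def)
  ultimately show ?thesis
    using wf_orbit_orbits by (simp add: wf_nfa_rep_def machine_rep_def)
qed

end

section \<open>The denoted automaton behaves like the abstract one\<close>

context machine
begin

definition st_elem :: "'b st \<Rightarrow> nat \<times> 'b list set" where
  "st_elem q = single (enc_st q)"

definition letter_elem :: "'b letter \<Rightarrow> nat \<times> 'b list set" where
  "letter_elem x = single (enc_letter (length rs) x)"

lemma st_elem_inj: "st_elem p = st_elem q \<Longrightarrow> p = q"
  unfolding st_elem_def by (blast dest: single_inj enc_st_inj)

lemma letter_elem_inj: "letter_ok x \<Longrightarrow> letter_ok y \<Longrightarrow> letter_elem x = letter_elem y \<Longrightarrow> x = y"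
  unfolding letter_elem_def by (blast dest: single_inj enc_letter_inj)

lemma element_st: "wf_st N q \<Longrightarrow> element (states_rep R) (enc_st q) = st_elem q"
  by (simp add: machine_rep_def wf_st_def st_elem_def element_orbits)

lemma element_letter:
  "letter_ok x \<Longrightarrow> element (alphabet_rep R) (enc_letter (length rs) x) = letter_elem x"
  by (simp add: machine_rep_def wf_letter_def letter_elem_def element_orbits)

lemma elements_st: "elements (states_rep R) = st_elem ` {q :: 'c st. wf_st N q}"
proof -
  have "{u. wf_tuple (orbits (st_dims N)) u} = enc_st ` {q :: 'c st. wf_st N q}"
    using enc_st_surj unfolding wf_st_def by blast
  then show ?thesis
    by (simp add: machine_rep_def elements_orbits image_image st_elem_def)
qed

lemma elements_letter: "elements (alphabet_rep R) = letter_elem ` {x :: 'c letter. letter_ok x}"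
proof -
  have "{u. wf_tuple (orbits (Suc t # letter_dims rs N)) u} =
      enc_letter (length rs) ` {x :: 'c letter. letter_ok x}"
    using enc_letter_surj[of "Suc t" rs N] unfolding wf_letter_def by blast
  then show ?thesis
    by (simp add: machine_rep_def elements_orbits image_image letter_elem_def)
qed

lemma enc_st_inverse: "g \<circ> f = id \<Longrightarrow> map_st g (map_st f q) = q"
  by (simp add: st.map_comp st.map_id)

lemma enc_letter_inverse: "g \<circ> f = id \<Longrightarrow> map_letter g (map_letter f x) = x"
  by (simp add: letter.map_comp letter.map_id)

lemma transitions_R:
  fixes P X Q :: "nat \<times> 'c::atom list set"
  shows "(P, X, Q) \<in> transitions (nfa_of R) \<longleftrightarrow>
    (\<exists>p x q. step rs a s t p x q \<and> wf_st N p \<and> letter_ok x \<and> wf_st N q \<and>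
       P = st_elem p \<and> X = letter_elem x \<and> Q = st_elem q)"
proof
  assume "(P, X, Q) \<in> transitions (nfa_of R)"
  then obtain p' x' q' \<rho> where u: "(p', x', q') \<in> set (transitions_rep R)" "inj (\<rho> :: nat \<Rightarrow> 'c)"
    and P: "P = element (states_rep R) (map_prod id (map \<rho>) p')"
    and X: "X = element (alphabet_rep R) (map_prod id (map \<rho>) x')"
    and Q: "Q = element (states_rep R) (map_prod id (map \<rho>) q')"
    by (auto simp: nfa_of_def)
  from rep_sound[OF u(1)] obtain p x q where
    e: "step rs a s t p x q" "wf_st N p" "letter_ok x" "wf_st N q"
    and "p' = enc_st p" "x' = enc_letter (length rs) x" "q' = enc_st q"
    by blast
  then have "P = st_elem (map_st \<rho> p)" "X = letter_elem (map_letter \<rho> x)"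
    "Q = st_elem (map_st \<rho> q)"
    using P X Q u(2)
    by (simp_all add: element_st element_letter wf_st_rename letter_ok_rename
        flip: enc_st_map enc_letter_map)
  then show "\<exists>p x q. step rs a s t p x q \<and> wf_st N p \<and> letter_ok x \<and> wf_st N q \<and>
       P = st_elem p \<and> X = letter_elem x \<and> Q = st_elem q"
    using step_rename[OF e(1) u(2) e(3)] wf_st_rename[OF u(2) e(2)]
      letter_ok_rename[OF u(2) e(3)] wf_st_rename[OF u(2) e(4)] by blast
next
  assume "\<exists>p x q. step rs a s t p x q \<and> wf_st N p \<and> letter_ok x \<and> wf_st N q \<and>
       P = st_elem p \<and> X = letter_elem x \<and> Q = st_elem q"
  then obtain p x q where e: "step rs a s t p x q" "wf_st N p" "letter_ok x" "wf_st N q"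
    and PXQ: "P = st_elem p" "X = letter_elem x" "Q = st_elem q"
    by blast
  let ?L = "length rs" and ?S = "sum_list (letter_dims rs N)"
  define us where "us = snd (enc_st p) @ snd (enc_letter ?L x) @ snd (enc_st q)"
  \<comment> \<open>The atoms to be renamed to 0, 1, and so on. For an \<open>Input\<close> letter
    they are its own tuple in its own order, as the representatives use \<open>[0..<Suc t]\<close>;
    otherwise any enumeration of the atoms of the triple keeps the names below the bound.\<close>
  define ys where "ys = (case x of Input xs \<Rightarrow> xs | _ \<Rightarrow> remdups us)"
  have "distinct ys"
    using e(3) by (cases x) (auto simp: ys_def)
  then obtain \<rho> :: "nat \<Rightarrow> 'c" where \<rho>: "bij \<rho>" "map \<rho> [0..<length ys] = ys"
    using ex_renaming by blast
  define g where "g = inv \<rho>"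
  have g: "\<rho> \<circ> g = id" "inj g" "g \<circ> \<rho> = id"
    unfolding g_def using \<rho>(1)
    by (simp_all add: bij_is_surj bij_is_inj bij_imp_bij_inv surj_iff[symmetric])
  have gys: "map g ys = [0..<length ys]"
    using arg_cong[OF \<rho>(2), of "map g"] g(3) by simp
  have mem: "(enc_st (map_st g p), enc_letter ?L (map_letter g x), enc_st (map_st g q))
      \<in> set (transitions_rep R)"
  proof (rule rep_complete)
    show "step rs a s t (map_st g p) (map_letter g x) (map_st g q)"
      using e g by (simp add: step_rename)
    show "wf_st N (map_st g p)" "wf_st N (map_st g q)" "letter_ok (map_letter g x)"
      using e g by (simp_all add: wf_st_rename letter_ok_rename)
    show "xs = [0..<Suc t]" if "map_letter g x = Input xs" for xs
      using that gys e(3) by (cases x) (simp_all add: ys_def del: upt_Suc)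
    assume "edge rs (map_st g p) (map_letter g x) (map_st g q)"
    then have x: "x \<noteq> Input xs" for xs
      using not_edge_Input by force
    then have ys: "ys = remdups us"
      by (cases x) (auto simp: ys_def)
    have "length (snd (enc_st p)) \<le> ?S" "length (snd (enc_letter ?L x)) \<le> ?S"
      "length (snd (enc_st q)) \<le> ?S"
      using e x by (auto intro: length_enc_st length_enc_letter)
    then have "length us \<le> 3 * ?S"
      by (simp add: us_def)
    then have len: "length ys \<le> 3 * ?S"
      using ys length_remdups_leq[of us] by (metis le_trans)
    have "g ` set us = {..<length ys}"
      using arg_cong[OF gys, of set] ys by (simp add: lessThan_atLeast0)
    then have "g ` set us \<subseteq> {..<3 * ?S}"
      using len by simp
    then show "set (snd (enc_st (map_st g p)) @ snd (enc_letter ?L (map_letter g x)) @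
        snd (enc_st (map_st g q))) \<subseteq> {..<3 * ?S}"
      by (simp add: us_def enc_st_map enc_letter_map image_Un)
  qed
  have "inj \<rho>" using \<rho>(1) by (rule bij_is_inj)
  have "P = element (states_rep R) (map_prod id (map \<rho>) (enc_st (map_st g p)))"
    "X = element (alphabet_rep R) (map_prod id (map \<rho>) (enc_letter ?L (map_letter g x)))"
    "Q = element (states_rep R) (map_prod id (map \<rho>) (enc_st (map_st g q)))"
    using PXQ e g(1) by (simp_all add: enc_st_inverse enc_letter_inverse element_st element_letter
        flip: enc_st_map enc_letter_map)
  with mem \<open>inj \<rho>\<close> show "(P, X, Q) \<in> transitions (nfa_of R)"
    unfolding nfa_of_def nominal_nfa.simps mem_Collect_eq by blast
qed

lemma accepts_R:
  fixes p :: "'c::atom st"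
  assumes "wf_st N p" "\<forall>x\<in>set w. letter_ok x"
  shows "accepts_from (nfa_of R) (st_elem p) (map letter_elem w) \<longleftrightarrow> acc p w"
  using assms
proof (induction w arbitrary: p)
  case Nil
  have "fst (enc_st p) = 4 \<longleftrightarrow> p = Fin" by (cases p) auto
  moreover have "st_elem p \<in> elements (states_rep R)"
    using Nil by (simp add: elements_st)
  ultimately show ?case
    by (simp add: nfa_of_def machine_rep_def st_elem_def)
next
  case (Cons x w)
  have "(st_elem p, letter_elem x, Q) \<in> transitions (nfa_of R) \<longleftrightarrow>
      (\<exists>q. step rs a s t p x q \<and> Q = st_elem q \<and> wf_st N q)" for Q
  proof -
    have x: "letter_ok x" using Cons.prems(2) by simp
    show ?thesis
      unfolding transitions_R
      using Cons.prems(1) x st_elem_inj letter_elem_inj[OF x] by blast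
  qed
  then have "accepts_from (nfa_of R) (st_elem p) (map letter_elem (x # w)) \<longleftrightarrow>
      (\<exists>q. step rs a s t p x q \<and> wf_st N q \<and>
        accepts_from (nfa_of R) (st_elem q) (map letter_elem w))"
    unfolding list.map accepts_from.simps by metis
  also have "\<dots> \<longleftrightarrow> (\<exists>q. step rs a s t p x q \<and> wf_st N q \<and> acc q w)"
    using Cons.IH Cons.prems(2) by (metis list.set_intros(2))
  also have "\<dots> \<longleftrightarrow> acc p (x # w)"
    using step_wf Cons.prems by (metis acc.simps(2) list.set_intros(1))
  finally show ?case .
qed

definition words :: "'b letter list set" where
  "words = {w. \<forall>x\<in>set w. letter_ok x}"

lemma lists_alphabet:
  "lists (alphabet (nfa_of R :: ('c::atom, _, _) nominal_nfa)) = map letter_elem ` words"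
proof -
  have "words = lists {x :: 'c letter. letter_ok x}"
    by (auto simp: words_def lists_eq_set)
  then show ?thesis
    by (simp add: nfa_of_def elements_letter lists_image)
qed

lemma state_language_R:
  fixes p :: "'c::atom st"
  assumes "wf_st N p" "w \<in> words"
  shows "map letter_elem w \<in> state_language (nfa_of R) (st_elem p) \<longleftrightarrow> acc p w"
  using assms accepts_R[of p w] lists_alphabet
  by (auto simp: state_language_def words_def)

lemma language_R: "language (nfa_of R) = state_language (nfa_of R) (st_elem (Init :: 'c::atom st))"
proof -
  have "fst (st_elem p) = 0 \<longleftrightarrow> p = Init" for p :: "'c st"
    by (cases p) (auto simp: st_elem_def)
  moreover have "initial (nfa_of R) = {x \<in> st_elem ` {q :: 'c st. wf_st N q}. fst x = 0}"
    unfolding elements_st[symmetric] by (simp add: nfa_of_def machine_rep_def)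
  ultimately have "initial (nfa_of R) = {st_elem (Init :: 'c st)}"
    by auto
  then show ?thesis by (simp add: language_def)
qed

lemma residual_R:
  "residual (nfa_of R :: ('c::atom, _, _) nominal_nfa) \<longleftrightarrow>
    (\<forall>q :: 'c st. wf_st N q \<longrightarrow> (\<exists>w\<in>words. \<forall>v\<in>words. acc q v \<longleftrightarrow> acc Init (w @ v)))"
proof -
  let ?A = "nfa_of R :: ('c, _, _) nominal_nfa"
  have eq: "state_language ?A (st_elem q) = left_quotient (map letter_elem w) (language ?A) \<longleftrightarrow>
      (\<forall>v\<in>words. acc q v \<longleftrightarrow> acc Init (w @ v))" if "wf_st N q" "w \<in> words" for q w
  proof -
    let ?X = "map letter_elem ` words :: (nat \<times> 'c list set) list set"
    have sub: "state_language ?A p \<subseteq> ?X" for p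
      unfolding lists_alphabet[symmetric] by (auto simp: state_language_def)
    have "left_quotient (map letter_elem w) (language ?A) \<subseteq> ?X"
    proof
      fix u assume "u \<in> left_quotient (map letter_elem w) (language ?A)"
      then have "map letter_elem w @ u \<in> lists (alphabet ?A)"
        unfolding lists_alphabet using sub[of "st_elem Init"]
        by (auto simp: left_quotient_def language_R)
      then show "u \<in> ?X" unfolding lists_alphabet[symmetric] by simp
    qed
    then have "state_language ?A (st_elem q) = left_quotient (map letter_elem w) (language ?A) \<longleftrightarrow>
        (\<forall>v\<in>words. map letter_elem v \<in> state_language ?A (st_elem q) \<longleftrightarrow>
          map letter_elem v \<in> left_quotient (map letter_elem w) (language ?A))"
      using sub[of "st_elem q"] by blast
    also have "\<dots> \<longleftrightarrow> (\<forall>v\<in>words. acc q v \<longleftrightarrow> acc Init (w @ v))"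
    proof (rule ball_cong[OF refl])
      fix v :: "'c letter list" assume v: "v \<in> words"
      with that have "w @ v \<in> words" by (auto simp: words_def)
      then have "map letter_elem v \<in> left_quotient (map letter_elem w) (language ?A) \<longleftrightarrow>
          acc Init (w @ v)"
        using state_language_R[of Init "w @ v"] by (simp add: left_quotient_def language_R)
      then show "(map letter_elem v \<in> state_language ?A (st_elem q) \<longleftrightarrow>
          map letter_elem v \<in> left_quotient (map letter_elem w) (language ?A)) \<longleftrightarrow>
          (acc q v \<longleftrightarrow> acc Init (w @ v))"
        using state_language_R[OF that(1) v] by simp
    qed
    finally show ?thesis .
  qed
  have states: "states ?A = st_elem ` {q. wf_st N q}"
    by (simp add: nfa_of_def elements_st)
  show ?thesis
    unfolding residual_def states lists_alphabet
    using eq by (simp add: ball_simps bex_simps)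
qed

text \<open>A word that makes \<open>Top\<close> residual puts every word accepted from
  \<open>Top\<close> into the language of \<open>Pre\<close>, which omits exactly the valid
  derivations. Without valid derivations the two languages agree.\<close>

theorem residual_iff:
  "residual (nfa_of R :: ('c::atom, _, _) nominal_nfa) \<longleftrightarrow>
    \<not> (\<exists>(xs :: 'c list) w. length xs = Suc t \<and> distinct xs \<and>
         (\<forall>x\<in>set w. wf_instance rs x) \<and> valid xs w)"
  (is "_ \<longleftrightarrow> \<not> ?V")
proof
  assume residual: "residual (nfa_of R :: ('c::atom, _, _) nominal_nfa)"
  show "\<not> ?V"
  proof
    assume ?V
    then obtain xs :: "'c list" and w where
      w: "length xs = Suc t" "distinct xs" "\<forall>x\<in>set w. wf_instance rs x" "valid xs w"
      by blast
    let ?v = "Input xs # word w"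
    have "\<exists>u\<in>words. \<forall>v\<in>words. acc (Top :: 'c st) v \<longleftrightarrow> acc Init (u @ v)"
      using residual unfolding residual_R by simp
    then obtain u :: "'c letter list" where "\<forall>v\<in>words. acc Top v \<longleftrightarrow> acc Init (u @ v)" ..
    moreover have "?v \<in> words" using w by (auto simp: words_def)
    ultimately have "acc Init (u @ ?v)" using acc_Top by blast
    then have "acc Pre ?v" by (rule acc_Init_append_Input)
    then show False
      using w(4) unfolding acc_Pre by (auto dest: map_injective simp: inj_on_def)
  qed
next
  assume none: "\<not> ?V"
  have Pre_Top: "acc Pre v \<longleftrightarrow> acc Top v" if "v \<in> words" for v :: "'c letter list"
  proof -
    have "\<not> valid xs w" if "v = Input xs # word w" for xs w
      using none that \<open>v \<in> words\<close> by (auto simp: words_def)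
    then show ?thesis unfolding acc_Pre acc_Top by blast
  qed
  have Anchor: "acc Init ([Anchor q] @ v) \<longleftrightarrow> acc q v" if "q \<noteq> Init" "q \<noteq> Top"
    for q :: "'c st" and v
    unfolding acc_Init using that by auto
  show "residual (nfa_of R :: ('c::atom, _, _) nominal_nfa)"
    unfolding residual_R
  proof (intro allI impI)
    fix q :: "'c st"
    assume q: "wf_st N q"
    consider "q = Init" | "q = Top" | "q \<noteq> Init" "q \<noteq> Top" by blast
    then show "\<exists>w\<in>words. \<forall>v\<in>words. acc q v \<longleftrightarrow> acc Init (w @ v)"
    proof cases
      case 1
      then show ?thesis by (intro bexI[of _ "[]"]) (auto simp: words_def)
    next
      case 2
      \<comment> \<open>\<open>Top\<close> borrows the anchor of \<open>Pre\<close>, having none of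
        its own.\<close>
      then show ?thesis
        using Pre_Top Anchor[of Pre] by (intro bexI[of _ "[Anchor Pre]"]) (auto simp: words_def)
    next
      case 3
      then show ?thesis
        using q Anchor[of q] by (intro bexI[of _ "[Anchor q]"]) (auto simp: words_def)
    qed
  qed
qed

end

section \<open>Diagonalisation\<close>

text \<open>The source has an empty tuple since \<open>Input\<close> is read only in
  \<open>Pre\<close> and \<open>Top\<close>; \<open>Zero\<close> is the orbit index of
  \<open>Input\<close>.\<close>

definition recf_transition :: "nat \<Rightarrow> recf \<Rightarrow> nat \<Rightarrow> recf \<Rightarrow> recf" where
  "recf_transition p u q vs =
     recf_pair (recf_const (encode_tuple (p, [])))
       (recf_pair (recf_pair Zero u) (recf_pair (recf_const q) vs))"

lemma computes_transition:
  assumes "computes u xs (list_encode us)" "computes v xs (list_encode vs)"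
  shows "computes (recf_transition p u q v) xs (encode_transition ((p, []), (0, us), (q, vs)))"
  unfolding recf_transition_def encode_transition_def
  using assms by (auto simp: encode_tuple_def intro!: computes_pair computes_const zero)

text \<open>The number \<open>t\<close> is passed twice: as the recursion argument it is the length
  of the chain, and as a parameter it is both the start value, being the code of \<open>T\<close>,
  and, as \<open>Proj 4\<close> in the step, the source of the input tuple.\<close>

definition recf_chain :: recf where
  "recf_chain =
     Comp (PrimRec (Proj 2)
        (recf_Cons (recf_transition 1 (recf_upt (Proj 4)) (8 + to_nat PS)
           (recf_list [Proj 0, recf_Suc (Proj 0)])) (Proj 1)))
      [Proj 2, Proj 0, Proj 1, Proj 2]"

definition recf_nfa :: recf where
  "recf_nfa = recf_list
     [recf_Cons (recf_pair (recf_Suc (Proj 2)) (recf_list [recf_upt (Proj 2)])) (Proj 0),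
      Proj 1,
      recf_const (list_encode [0]),
      recf_const (list_encode [4]),
      recf_Cons (recf_transition 2 (recf_upt (Proj 2)) 3 (recf_list []))
     (recf_Cons (recf_transition 1 (recf_upt (Proj 2)) 5 (recf_list []))
     (recf_Cons (recf_transition 1 (recf_upt (Proj 2)) (8 + to_nat PZ) (recf_list [Zero]))
     (recf_Cons (recf_transition 1 (recf_upt (Proj 2)) (8 + to_nat PGoal)
        (recf_list [Proj 0, Proj 1, Proj 2, recf_const 1]))
      recf_chain)))]"

lemma computes_chain:
  assumes "t = list_encode (map encode_transition T)"
  shows "computes recf_chain [a, s, t] (list_encode (map encode_transition
     (map (\<lambda>k. ((1, []), (0, [0..<Suc t]), (8 + to_nat PS, [k, Suc k]))) (rev [0..<t]) @ T)))"
proof -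
  let ?tr = "\<lambda>k. ((1, []), (0, [0..<Suc t]), (8 + to_nat PS, [k, Suc k]))"
  let ?g = "recf_Cons (recf_transition 1 (recf_upt (Proj 4)) (8 + to_nat PS)
     (recf_list [Proj 0, recf_Suc (Proj 0)])) (Proj 1)"
  let ?F = "\<lambda>k. list_encode (map encode_transition (map ?tr (rev [0..<k]) @ T))"
  have "computes (PrimRec (Proj 2) ?g) [t, a, s, t] (?F t)"
  proof (rule computes_PrimRec[where F = ?F])
    show "computes (Proj 2) [a, s, t] (?F 0)"
      by (rule computes_Proj) (simp_all add: assms)
    fix k
    have "computes ?g [k, ?F k, a, s, t]
      (list_encode (encode_transition (?tr k) # map encode_transition (map ?tr (rev [0..<k]) @ T)))"
      by (intro computes_Cons computes_transition computes_upt computes_list list.rel_intros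
          computes_Suc computes_Proj) simp_all
    then show "computes ?g [k, ?F k, a, s, t] (?F (Suc k))"
      by simp
  qed
  moreover have "list_all2 (\<lambda>g. computes g [a, s, t]) [Proj 2, Proj 0, Proj 1, Proj 2] [t, a, s, t]"
    by (intro list.rel_intros computes_Proj) simp_all
  ultimately show ?thesis
    unfolding recf_chain_def by (rule computes.comp[rotated])
qed

lemma computes_nfa:
  assumes "a = list_encode (map encode_orbit (orbits (letter_dims rs N)))"
    and "s = list_encode (map encode_orbit (orbits (st_dims N)))"
    and "t = list_encode (map encode_transition T)"
  shows "computes recf_nfa [a, s, t] (encode_nfa (machine_rep rs N a s t T))"
proof -
  let ?U = "[0..<Suc t]" and ?xs = "[a, s, t]"
  let ?chain = "map encode_transition
     (map (\<lambda>k. ((1, []), (0, [0..<Suc t]), (8 + to_nat PS, [k, Suc k]))) (rev [0..<t]) @ T)"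
  have alphabet: "computes
      (recf_Cons (recf_pair (recf_Suc (Proj 2)) (recf_list [recf_upt (Proj 2)])) (Proj 0)) ?xs
      (list_encode (encode_orbit (Suc t, [?U]) # map encode_orbit (orbits (letter_dims rs N))))"
    unfolding encode_orbit_def prod.case list.map
    by (intro computes_Cons computes_pair computes_Suc computes_list list.rel_intros computes_upt
        computes_Proj) (simp_all add: assms(1) encode_orbit_def)
  have transitions: "computes
     (recf_Cons (recf_transition 2 (recf_upt (Proj 2)) 3 (recf_list []))
     (recf_Cons (recf_transition 1 (recf_upt (Proj 2)) 5 (recf_list []))
     (recf_Cons (recf_transition 1 (recf_upt (Proj 2)) (8 + to_nat PZ) (recf_list [Zero]))
     (recf_Cons (recf_transition 1 (recf_upt (Proj 2)) (8 + to_nat PGoal)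
        (recf_list [Proj 0, Proj 1, Proj 2, recf_const 1]))
      recf_chain)))) ?xs
     (list_encode (
       encode_transition ((2, []), (0, ?U), (3, [])) #
       encode_transition ((1, []), (0, ?U), (5, [])) #
       encode_transition ((1, []), (0, ?U), (8 + to_nat PZ, [0])) #
       encode_transition ((1, []), (0, ?U), (8 + to_nat PGoal, [a, s, t, 1])) # ?chain))"
    by (intro computes_Cons computes_transition computes_list list.rel_intros computes_upt
        computes_Proj computes_chain computes_const zero assms(3)) simp_all
  have "computes recf_nfa ?xs (list_encode
    [list_encode (encode_orbit (Suc t, [?U]) # map encode_orbit (orbits (letter_dims rs N))),
     s, list_encode [0], list_encode [4],
     list_encode (
       encode_transition ((2, []), (0, ?U), (3, [])) #
       encode_transition ((1, []), (0, ?U), (5, [])) #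
       encode_transition ((1, []), (0, ?U), (8 + to_nat PZ, [0])) #
       encode_transition ((1, []), (0, ?U), (8 + to_nat PGoal, [a, s, t, 1])) # ?chain)])"
    unfolding recf_nfa_def
    by (intro computes_list list.rel_intros alphabet transitions computes_const computes_Proj) simp_all
  then show ?thesis
    by (simp add: encode_nfa_def machine_rep_def orbits_def input_transitions_def assms(2)
        del: upt_Suc list_encode.simps(2))
qed

lemma length_le_list_encode: "length xs \<le> list_encode xs"
proof (induction xs)
  case (Cons x xs)
  then show ?case using le_prod_encode_2[of "list_encode xs" x] by simp
qed simp

text \<open>Serves to compare \<open>s\<close> with \<open>a\<close>: the state orbits form the tail
  of the letter orbits.\<close>

lemma list_encode_append_le: "list_encode ys \<le> list_encode (xs @ ys)"
proof (induction xs)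
  case (Cons x xs)
  then show ?case using le_prod_encode_2[of "list_encode (xs @ ys)" x] by simp
qed simp

theorem proposition5p4:
  shows "\<not> decidable_problem encode_nfa {R. wf_nfa_rep R}
           (\<lambda>R. residual (nfa_of R :: ('a::atom, nat \<times> 'a list set, nat \<times> 'a list set) nominal_nfa))"
proof
  let ?res = "\<lambda>R. residual (nfa_of R :: ('a, nat \<times> 'a list set, nat \<times> 'a list set) nominal_nfa)"
  assume "decidable_problem encode_nfa {R. wf_nfa_rep R} ?res"
  then obtain f where f: "\<And>R. wf_nfa_rep R \<Longrightarrow> computes f [encode_nfa R] (if ?res R then 1 else 0)"
    unfolding decidable_problem_def by auto
  define h where "h = Comp f [recf_nfa]"
  define rs where "rs = program h"
  obtain N where N: "bounded_preds N rs"
    using ex_bounded_preds by blast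
  define a where "a = list_encode (map encode_orbit (orbits (letter_dims rs N)))"
  define s where "s = list_encode (map encode_orbit (orbits (st_dims N)))"
  obtain ts where ts: "set ts = static_transitions rs N"
    using finite_list[OF finite_static_transitions] by blast
  \<comment> \<open>Some transition is needed for the padding; the edge from \<open>All\<close> to
    \<open>Fin\<close> exists for every program.\<close>
  have "static_transitions rs N \<noteq> {}"
    unfolding static_transitions_def using all_end by force
  then obtain tr where tr: "tr \<in> set ts"
    using ts by auto
  \<comment> \<open>The repetitions make \<open>t\<close> exceed \<open>a\<close>: the inputs of \<open>h\<close> must be named by distinct atoms.\<close>
  define T where "T = replicate (Suc a) tr @ ts"
  have T: "set T = static_transitions rs N"
    unfolding T_def set_append set_replicate[OF Suc_not_Zero] ts[symmetric] using tr by blast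
  define t where "t = list_encode (map encode_transition T)"
  \<comment> \<open>The eight fixed states keep \<open>s\<close> away from 1, the numeral of the
    expected result.\<close>
  have "8 \<le> length (map encode_orbit (orbits (st_dims N)))"
    by (simp add: orbits_def st_dims_def)
  then have "8 \<le> s"
    unfolding s_def using length_le_list_encode le_trans by blast
  have "s \<le> list_encode (map encode_orbit (orbits (map fst rs @ st_dims N)))"
    unfolding s_def orbits_def map_append by (rule list_encode_append_le)
  then have "s < a"
    unfolding a_def letter_dims_def orbits_def list.map list_encode.simps
    using le_prod_encode_2 by (meson le_imp_less_Suc le_trans)
  have "length (map encode_transition T) \<le> t"
    unfolding t_def by (rule length_le_list_encode)
  then have "a < t"
    by (simp add: T_def)
  interpret machine rs a s t N T
  proof
    show "\<forall>r\<in>set rs. wf_rule r" unfolding rs_def using wf_program by blast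
  qed (use N T \<open>8 \<le> s\<close> \<open>s < a\<close> \<open>a < t\<close> in auto)
  have code: "computes recf_nfa [a, s, t] (encode_nfa R)"
    using a_def s_def t_def by (rule computes_nfa)
  \<comment> \<open>The self-application: on the codes of its own fixed part, \<open>h\<close>
    returns the verdict of \<open>f\<close> on the automaton built from
    \<open>program h\<close>.\<close>
  have h: "computes h [a, s, t] (if ?res R then 1 else 0)"
    unfolding h_def by (rule computes.comp[OF _ f[OF wf_R]]) (simp add: code)
  show False
  proof (cases "?res R")
    case True
    with h have "computes h [a, s, t] 1" by simp
    from ex_justified[OF this input]
    have "\<exists>(xs :: 'a list) w. length xs = Suc t \<and> distinct xs \<and>
        (\<forall>x\<in>set w. wf_instance rs x) \<and> valid xs w"
      unfolding valid_def unfolding rs_def by meson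
    with True show False
      unfolding residual_iff by (rule notE)
  next
    case False
    then obtain xs :: "'a list" and w where "\<forall>x\<in>set w. wf_instance rs x" "valid xs w"
      unfolding residual_iff by blast
    then have "computes h [a, s, t] 1"
      using justified_sound[of h w a s t xs] input unfolding valid_def unfolding rs_def by blast
    moreover have "computes h [a, s, t] 0"
      using h False by simp
    ultimately show False
      using computes_fun by (metis zero_neq_one)
  qed
qed

end
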